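(* Let $d\ge1$, $b\ge2$, let $\Omega\subset[0,1]^d$ be measurable and $f=1_\Omega$, and let $\mu=\lambda_d(\Omega)$. Suppose $\Omega$ satisfies the following assumption: there exist a constant $c>0$ and $N_0\ge1$ such that for every $n=b^m\ge N_0$, $$\inf_{i\in\mathcal{T}_{\mathrm{bdy}}(n)}\mathrm{Var}(1_{\Omega}(X^{(i)}))\ge c,$$ and moreover $|\mathcal{T}_{\mathrm{bdy}}(n)|\to\infty$ as $n=b^m\to\infty$. Let $\hat{\mu}_n$ be the HSFC-based estimate of $\mu$ with $n=b^m$ points defined below. Then $$\frac{\hat{\mu}_{n}-\mu}{\sqrt{\mathrm{Var}(\hat{\mu}_{n})}}\to N(0,1)$$ in distribution as $n=b^m\to\infty$.
   Context: $\lambda_d$ is Lebesgue measure on $\mathbb{R}^d$. $H:[0,1]\to[0,1]^d$ denotes the $d$-dimensional Hilbert space-filling curve (the continuous surjection obtained as the limit of the standard recursive Hilbert curve construction, e.g. Butz's algorithm; for $d=1$, $H(x)=x$); it satisfies $\lambda_d(H([p,q]))=q-p$, and $H(x)$ is uniform on $H([p,q])$ when $x$ is uniform on $[p,q]$. For $n=b^m$ let $I_i=[(i-1)/n,i/n]$, $E_i=H(I_i)$ ($i=1,\dots,n$), let $X^{(i)}$ be uniformly distributed on $E_i$, so that $\mathrm{Var}(1_\Omega(X^{(i)}))=n\lambda_d(E_i\cap\Omega)(1-n\lambda_d(E_i\cap\Omega))$, and let $\mathcal{T}_{\mathrm{bdy}}(n)=\{1\le i\le n: E_i\cap\Omega\ne\emptyset\}\setminus\{1\le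 i\le n: E_i\subset\Omega\}$. Van der Corput sequence in base $b$: writing $i-1=\sum_{j\ge1}a_{ij}b^{j-1}$ with digits $a_{ij}\in\{0,\dots,b-1\}$, set $a_i=\sum_{j\ge1}a_{ij}b^{-j}$. Its nested uniform (Owen) scrambling is $x_i=\sum_{j\ge1}x_{ij}b^{-j}$ with $x_{i1}=\pi(a_{i1})$ and $x_{ij}=\pi_{a_{i1}\dots a_{i,j-1}}(a_{ij})$ for $j\ge 2$, where all these permutations are mutually independent and each uniformly distributed over the $b!$ permutations of $\{0,\dots,b-1\}$. The HSFC-based estimate is $\hat{\mu}_n=\frac1n\sum_{i=1}^n f(H(x_i))$ with $x_1,\dots,x_n$ the first $n=b^m$ scrambled points (equivalently, after reordering, the $x_i$ are independent with $x_i$ uniform on $I_i$, so $H(x_i)$ has the law of $X^{(i)}$). *)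

theory Defs
  imports "HOL-Probability.Probability"
begin

definition cell :: "(real \<Rightarrow> 'a) \<Rightarrow> nat \<Rightarrow> nat \<Rightarrow> 'a set" where
  "cell H n i = H ` {(real i - 1) / real n .. real i / real n}"

definition cell_var :: "(real \<Rightarrow> 'a::euclidean_space) \<Rightarrow> 'a set \<Rightarrow> nat \<Rightarrow> nat \<Rightarrow> real" where
  "cell_var H \<Omega> n i =
     (let U = uniform_measure lebesgue (cell H n i) in
      integral\<^sup>L U (\<lambda>x. (indicator \<Omega> x - integral\<^sup>L U (indicator \<Omega>))\<^sup>2))"

definition T_bdy :: "(real \<Rightarrow> 'a) \<Rightarrow> 'a set \<Rightarrow> nat \<Rightarrow> nat set" where
  "T_bdy H \<Omega> n = {i \<in> {1..n}. cell H n i \<inter> \<Omega> \<noteq> {}} - {i \<in> {1..n}. cell H n i \<subseteq> \<Omega>}"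

definition digit :: "nat \<Rightarrow> nat \<Rightarrow> nat \<Rightarrow> nat" where
  "digit b i j = ((i - 1) div b ^ (j - 1)) mod b"

text \<open>Nested uniform scrambling: omega assigns to every digit prefix (a list) a permutation;
  the empty prefix gives pi, the prefix [a_i1,...,a_{i,j-1}] gives pi_{a_i1...a_{i,j-1}}.\<close>
definition scr_digit :: "nat \<Rightarrow> (nat list \<Rightarrow> nat \<Rightarrow> nat) \<Rightarrow> nat \<Rightarrow> nat \<Rightarrow> nat" where
  "scr_digit b \<omega> i j = \<omega> (map (digit b i) [1..<j]) (digit b i j)"

definition scr_point :: "nat \<Rightarrow> (nat list \<Rightarrow> nat \<Rightarrow> nat) \<Rightarrow> nat \<Rightarrow> real" where
  "scr_point b \<omega> i = (\<Sum>j. real (scr_digit b \<omega> i (Suc j)) / real b ^ Suc j)"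

definition scr_space :: "nat \<Rightarrow> (nat list \<Rightarrow> nat \<Rightarrow> nat) measure" where
  "scr_space b = completion
     (PiM (UNIV :: nat list set) (\<lambda>_. uniform_count_measure {p. p permutes {0..<b}}))"

definition mu_hat :: "nat \<Rightarrow> (real \<Rightarrow> 'a) \<Rightarrow> 'a set \<Rightarrow> nat \<Rightarrow> (nat list \<Rightarrow> nat \<Rightarrow> nat) \<Rightarrow> real" where
  "mu_hat b H \<Omega> n \<omega> = (1 / real n) * (\<Sum>i = 1..n. indicator \<Omega> (H (scr_point b \<omega> i)))"

definition est_var :: "nat \<Rightarrow> (real \<Rightarrow> 'a) \<Rightarrow> 'a set \<Rightarrow> nat \<Rightarrow> real" where
  "est_var b H \<Omega> n =
     (let M = scr_space b; X = mu_hat b H \<Omega> n in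
      integral\<^sup>L M (\<lambda>\<omega>. (X \<omega> - integral\<^sup>L M X)\<^sup>2))"

end

theory Submission
  imports Defs
begin

text \<open>The first \<open>m\<close> scrambled digits distribute the \<open>n = b ^ m\<close> points bijectively over the \<open>n\<close> cells of
  length \<open>1 / n\<close> and depend only on permutations attached to prefixes of length less than \<open>m\<close>. The
  remaining digits of different points use disjoint sets of permutations, attached to longer
  prefixes, so the positions of the points within their cells are i.i.d. uniform. Hence
  the estimate is a sum of independent Bernoulli variables, one per cell, whose variances are
  the cell variances. Their total is at least \<open>c\<close> times the number of boundary cells and so
  tends to infinity, and for bounded summands this suffices for the central limit theorem:
  comparing each characteristic function with the Gaussian one of the same variance leaves
  a total error of order \<open>v powr (- 1 / 2)\<close> for total variance \<open>v\<close>.\<close>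

section \<open>A central limit theorem for bounded triangular arrays\<close>

text \<open>The main obstacle is that a given point has no fixed cell: which cell it enters is
  random, and the cells of different points are dependent. Independence becomes visible only after
  relabelling by cell, which turns each position into a tail selected by a random index; hence the
  partition of the sample space by the finitely many possible assignments. A second obstacle is that
  \<open>\<Omega>\<close> is only Lebesgue measurable, so \<open>mu_hat\<close> is shown to be
  measurable only for the completed product measure. It is replaced almost surely by a Borel
  expression on the uncompleted space, where independence is available, and its law and variance are
  then carried back. The curve enters mainly through measure preservation: the chance that the point
  of a cell hits \<open>\<Omega>\<close> is \<open>n\<close> times the measure of
  \<open>\<Omega>\<close> in the image cell, the number behind \<open>cell_var\<close>. The order of
  the error is that of \<open>v / v powr (3 / 2)\<close>: summands of absolute value at most 1 have
  third moments dominated by their variances.\<close>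

lemma (in prob_space) variance_indep_sum:
  fixes X :: "'i \<Rightarrow> 'a \<Rightarrow> real"
  assumes "finite I" "indep_vars (\<lambda>_. borel) X I"
    and "\<And>i. i \<in> I \<Longrightarrow> integrable M (\<lambda>\<omega>. (X i \<omega>)\<^sup>2)"
    and "\<And>i. i \<in> I \<Longrightarrow> expectation (X i) = 0"
  shows "integrable M (\<lambda>\<omega>. (\<Sum>i\<in>I. X i \<omega>)\<^sup>2) \<and>
    expectation (\<lambda>\<omega>. (\<Sum>i\<in>I. X i \<omega>)\<^sup>2) = (\<Sum>i\<in>I. expectation (\<lambda>\<omega>. (X i \<omega>)\<^sup>2))"
  using assms
proof (induction I rule: finite_induct)
  case (insert i I)
  have rv: "random_variable borel (X j)" if "j \<in> insert i I" for j
    using insert.prems(1) that by (auto simp: indep_vars_def2)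
  have int1: "integrable M (X j)" if "j \<in> insert i I" for j
    by (rule square_integrable_imp_integrable[OF rv[OF that] insert.prems(2)[OF that]])
  have IH: "integrable M (\<lambda>\<omega>. (\<Sum>i\<in>I. X i \<omega>)\<^sup>2)"
    "expectation (\<lambda>\<omega>. (\<Sum>i\<in>I. X i \<omega>)\<^sup>2) = (\<Sum>i\<in>I. expectation (\<lambda>\<omega>. (X i \<omega>)\<^sup>2))"
    using insert.IH insert.prems indep_vars_subset[OF insert.prems(1), of I] by auto
  have iv: "indep_var borel (X i) borel (\<lambda>\<omega>. \<Sum>i\<in>I. X i \<omega>)"
    using insert by (intro indep_vars_sum) auto
  have intS: "integrable M (\<lambda>\<omega>. \<Sum>i\<in>I. X i \<omega>)" using int1 by auto
  have eq: "(\<Sum>j\<in>insert i I. X j \<omega>)\<^sup>2 = (X i \<omega>)\<^sup>2 + (\<Sum>i\<in>I. X i \<omega>)\<^sup>2 + 2 * (X i \<omega> * (\<Sum>i\<in>I. X i \<omega>))" for \<omega>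
    using insert.hyps by (simp add: power2_eq_square algebra_simps)
  have p: "integrable M (\<lambda>\<omega>. X i \<omega> * (\<Sum>i\<in>I. X i \<omega>))"
    by (rule indep_var_integrable[OF iv _ intS]) (use int1 in auto)
  have p0: "expectation (\<lambda>\<omega>. X i \<omega> * (\<Sum>i\<in>I. X i \<omega>)) = 0"
    using indep_var_lebesgue_integral[OF iv _ intS] int1 insert.prems(3) by simp
  show ?case
    unfolding eq using insert.hyps insert.prems(2) IH p p0 by simp
qed auto

lemma exp_minus_approx:
  fixes x :: real
  assumes "0 \<le> x"
  shows "\<bar>exp (- x) - (1 - x)\<bar> \<le> x\<^sup>2 / 2"
proof -
  have 1: "exp (-x) \<ge> 1 - x" using exp_ge_add_one_self[of "-x"] by simp
  \<comment> \<open>Since \<open>g 0 = - 1\<close>, monotonicity of \<open>g\<close> on the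
    nonnegative reals is exactly the upper estimate; its derivative is nonnegative by the same
    inequality that gave the lower one.\<close>
  define g :: "real \<Rightarrow> real" where "g y = y\<^sup>2 / 2 - y - exp (- y)" for y
  have "g 0 \<le> g x"
  proof (rule DERIV_nonneg_imp_nondecreasing[OF assms])
    fix y :: real
    have "(g has_real_derivative y - 1 + exp (- y)) (at y)"
      unfolding g_def[abs_def] by (auto intro!: derivative_eq_intros)
    moreover have "0 \<le> y - 1 + exp (- y)" using exp_ge_add_one_self[of "- y"] by simp
    ultimately show "\<exists>z. (g has_real_derivative z) (at y) \<and> 0 \<le> z" by blast
  qed
  hence "exp (- x) - (1 - x) \<le> x\<^sup>2 / 2" by (simp add: g_def)
  with 1 show ?thesis by simp
qed

text \<open>Both functions are compared with the common Taylor polynomial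
  \<open>1 - u\<^sup>2 * v / 2\<close>. Boundedness by 1 turns the third absolute moment into
  \<open>v\<close>, and \<open>v \<le> 1\<close> turns \<open>v\<^sup>2\<close> into
  \<open>v\<close>. The error is thus linear in \<open>v\<close>, so that over many summands it adds
  up to a multiple of the total variance.\<close>

lemma (in prob_space) char_bounded_approx:
  fixes X :: "'a \<Rightarrow> real"
  assumes [measurable]: "random_variable borel X"
    and bd: "\<And>\<omega>. \<omega> \<in> space M \<Longrightarrow> \<bar>X \<omega>\<bar> \<le> 1"
    and mean: "expectation X = 0"
  defines "v \<equiv> expectation (\<lambda>\<omega>. (X \<omega>)\<^sup>2)"
  shows "cmod (char (distr M borel X) u - exp (- (u\<^sup>2 * v / 2))) \<le> (\<bar>u\<bar> ^ 3 / 6 + u ^ 4 / 8) * v"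
proof -
  have sq: "(X \<omega>)\<^sup>2 \<le> 1" if "\<omega> \<in> space M" for \<omega>
    using bd[OF that] by (simp add: abs_square_le_1)
  have i2: "integrable M (\<lambda>\<omega>. (X \<omega>)\<^sup>2)"
    by (rule integrable_const_bound[of _ 1]) (use sq in auto)
  have i1: "integrable M X"
    by (rule integrable_const_bound[of _ 1]) (use bd in auto)
  have v0: "0 \<le> v" unfolding v_def by simp
  have "v \<le> expectation (\<lambda>_. 1)"
    unfolding v_def by (rule integral_mono[OF i2]) (use sq in auto)
  hence v1: "v \<le> 1" by (simp add: prob_space)
  have "cmod (char (distr M borel X) u - (1 - u\<^sup>2 * v / 2))
      \<le> (u\<^sup>2 / 6) * expectation (\<lambda>x. min (6 * (X x)^2) (\<bar>u\<bar> * \<bar>X x\<bar>^3))"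
    by (rule char_approx3'[OF _ i1 i2 mean]) (auto simp: mean v_def)
  also have "\<dots> \<le> (u\<^sup>2 / 6) * expectation (\<lambda>x. \<bar>u\<bar> * (X x)\<^sup>2)"
  proof (rule mult_left_mono[OF integral_mono])
    show "integrable M (\<lambda>x. min (6 * (X x)^2) (\<bar>u\<bar> * \<bar>X x\<bar>^3))"
    proof (rule integrable_const_bound[of _ 6])
      have "norm (min (6 * (X x)^2) (\<bar>u\<bar> * \<bar>X x\<bar>^3)) \<le> 6" if "x \<in> space M" for x
        using sq[OF that] min.cobounded1[of "6 * (X x)\<^sup>2" "\<bar>u\<bar> * \<bar>X x\<bar>^3"]
        by (simp only: real_norm_def abs_of_nonneg min_def split: if_splits) auto
      thus "AE x in M. norm (min (6 * (X x)^2) (\<bar>u\<bar> * \<bar>X x\<bar>^3)) \<le> 6" by (rule AE_I2)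
    qed measurable
    fix x assume "x \<in> space M"
    have "\<bar>X x\<bar>^3 = \<bar>X x\<bar> * (X x)\<^sup>2" by (simp add: power3_eq_cube power2_eq_square)
    also have "\<dots> \<le> 1 * (X x)\<^sup>2" using bd[OF \<open>x \<in> space M\<close>] by (intro mult_right_mono) auto
    finally show "min (6 * (X x)^2) (\<bar>u\<bar> * \<bar>X x\<bar>^3) \<le> \<bar>u\<bar> * (X x)\<^sup>2"
      by (intro min.coboundedI2 mult_left_mono) auto
  qed (use i2 in auto)
  also have "(u\<^sup>2 / 6) * expectation (\<lambda>x. \<bar>u\<bar> * (X x)\<^sup>2) = \<bar>u\<bar>\<^sup>2 / 6 * (\<bar>u\<bar> * v)"
    by (simp add: v_def)
  also have "\<dots> = \<bar>u\<bar>^3 / 6 * v"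
    by (simp only: power3_eq_cube power2_eq_square times_divide_eq_left mult.assoc)
  finally have A: "cmod (char (distr M borel X) u - (1 - u\<^sup>2 * v / 2)) \<le> \<bar>u\<bar>^3 / 6 * v" .
  have "cmod (complex_of_real (1 - u\<^sup>2 * v / 2) - complex_of_real (exp (- (u\<^sup>2 * v / 2)))) \<le> (u\<^sup>2 * v / 2)\<^sup>2 / 2"
    unfolding of_real_diff[symmetric] norm_of_real
    using exp_minus_approx[of "u\<^sup>2 * v / 2"] v0 by (simp add: abs_minus_commute)
  also have "\<dots> = u^4 / 8 * (v * v)"
    by (simp add: power2_eq_square power4_eq_xxxx)
  also have "\<dots> \<le> u^4 / 8 * (v * 1)"
    using v0 v1 by (intro mult_left_mono) auto
  finally have B: "cmod (complex_of_real (1 - u\<^sup>2 * v / 2) - complex_of_real (exp (- (u\<^sup>2 * v / 2)))) \<le> u^4 / 8 * v" by simp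
  have "cmod (char (distr M borel X) u - exp (- (u\<^sup>2 * v / 2))) \<le>
    cmod (char (distr M borel X) u - (1 - u\<^sup>2 * v / 2)) + cmod (complex_of_real (1 - u\<^sup>2 * v / 2) - complex_of_real (exp (- (u\<^sup>2 * v / 2))))"
    by (rule order_trans[OF _ norm_triangle_ineq]) simp
  with A B show ?thesis by (simp add: ring_distribs)
qed

lemma char_distr_divide:
  assumes [measurable]: "X \<in> borel_measurable M"
  shows "char (distr M borel (\<lambda>\<omega>. X \<omega> / s)) t = char (distr M borel X) (t / s)"
  by (simp add: char_def integral_distr)

text \<open>With \<open>u = t / sqrt v\<close> the Gaussian value factors as the product of
  \<open>exp (- (u\<^sup>2 * w i / 2))\<close>, because the \<open>w i\<close> sum to
  \<open>v\<close>. Products of numbers in the closed unit disc differ by at most the sum of the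
  differences of their factors, which reduces the claim to one summand at a time.\<close>

lemma (in prob_space) char_bounded_sum_approx:
  fixes X :: "'i \<Rightarrow> 'a \<Rightarrow> real"
  assumes fin: "finite I" and ind: "indep_vars (\<lambda>_. borel) X I"
    and bd: "\<And>i \<omega>. i \<in> I \<Longrightarrow> \<omega> \<in> space M \<Longrightarrow> \<bar>X i \<omega>\<bar> \<le> 1"
    and mean: "\<And>i. i \<in> I \<Longrightarrow> expectation (X i) = 0"
  defines "v \<equiv> \<Sum>i\<in>I. expectation (\<lambda>\<omega>. (X i \<omega>)\<^sup>2)"
  assumes v: "v > 0"
  shows "cmod (char (distr M borel (\<lambda>\<omega>. (\<Sum>i\<in>I. X i \<omega>) / sqrt v)) t - exp (- (t\<^sup>2 / 2)))
    \<le> \<bar>t\<bar> ^ 3 / (6 * sqrt v) + t ^ 4 / (8 * v)"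
proof -
  define u where "u = t / sqrt v"
  define w where "w i = expectation (\<lambda>\<omega>. (X i \<omega>)\<^sup>2)" for i
  have vw: "v = (\<Sum>i\<in>I. w i)" by (simp add: v_def w_def)
  have rv[measurable]: "random_variable borel (X j)" if "j \<in> I" for j
    using ind that by (auto simp: indep_vars_def2)
  have u2: "u\<^sup>2 * v = t\<^sup>2" using v by (simp add: u_def power_divide)
  have "char (distr M borel (\<lambda>\<omega>. (\<Sum>i\<in>I. X i \<omega>) / sqrt v)) t = char (distr M borel (\<lambda>\<omega>. \<Sum>i\<in>I. X i \<omega>)) u"
    unfolding u_def by (rule char_distr_divide) simp
  also have "\<dots> = (\<Prod>i\<in>I. char (distr M borel (X i)) u)"
    by (rule char_distr_sum[OF ind])
  finally have 1: "char (distr M borel (\<lambda>\<omega>. (\<Sum>i\<in>I. X i \<omega>) / sqrt v)) t = (\<Prod>i\<in>I. char (distr M borel (X i)) u)" .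
  have "exp (- (t\<^sup>2 / 2)) = exp (\<Sum>i\<in>I. - (u\<^sup>2 * w i / 2))"
    by (simp add: u2[symmetric] vw sum_negf sum_distrib_left sum_divide_distrib)
  also have "\<dots> = (\<Prod>i\<in>I. exp (- (u\<^sup>2 * w i / 2)))" by (rule exp_sum[OF fin])
  finally have 2: "complex_of_real (exp (- (t\<^sup>2 / 2))) = (\<Prod>i\<in>I. complex_of_real (exp (- (u\<^sup>2 * w i / 2))))"
    by simp
  have "cmod ((\<Prod>i\<in>I. char (distr M borel (X i)) u) - (\<Prod>i\<in>I. complex_of_real (exp (- (u\<^sup>2 * w i / 2)))))
     \<le> (\<Sum>i\<in>I. cmod (char (distr M borel (X i)) u - complex_of_real (exp (- (u\<^sup>2 * w i / 2)))))"
  proof (rule norm_prod_diff)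
    fix i assume "i \<in> I"
    interpret D: real_distribution "distr M borel (X i)" using rv[OF \<open>i \<in> I\<close>] by (rule real_distribution_distr)
    show "cmod (char (distr M borel (X i)) u) \<le> 1" by (rule D.cmod_char_le_1)
    show "cmod (complex_of_real (exp (- (u\<^sup>2 * w i / 2)))) \<le> 1" 
      unfolding norm_of_real by (simp add: w_def)
  qed
  also have "\<dots> \<le> (\<Sum>i\<in>I. (\<bar>u\<bar> ^ 3 / 6 + u ^ 4 / 8) * w i)"
    unfolding w_def by (intro sum_mono char_bounded_approx rv bd mean)
  also have "\<dots> = (\<bar>u\<bar> ^ 3 / 6 + u ^ 4 / 8) * v" by (simp add: sum_distrib_left vw)
  also have "u ^ 4 = t ^ 4 / v\<^sup>2"
    using v by (simp add: u_def power_divide power4_eq_xxxx power2_eq_square)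
  also have "\<bar>u\<bar>^3 = \<bar>t\<bar>^3 / (v * sqrt v)"
    using v by (simp add: u_def power_divide power3_eq_cube)
  also have "(\<bar>t\<bar>^3 / (v * sqrt v) / 6 + t ^ 4 / v\<^sup>2 / 8) * v = \<bar>t\<bar> ^ 3 / (6 * sqrt v) + t ^ 4 / (8 * v)"
    using v by (simp add: field_simps power2_eq_square)
  finally show ?thesis unfolding 1 2 .
qed

theorem clt_triangular_bounded:
  fixes M :: "nat \<Rightarrow> 'a measure" and X :: "nat \<Rightarrow> 'i \<Rightarrow> 'a \<Rightarrow> real"
  assumes prob: "\<And>n. prob_space (M n)"
    and fin: "\<And>n. finite (I n)"
    and ind: "\<And>n. prob_space.indep_vars (M n) (\<lambda>_. borel) (X n) (I n)"
    and bd: "\<And>n i \<omega>. i \<in> I n \<Longrightarrow> \<omega> \<in> space (M n) \<Longrightarrow> \<bar>X n i \<omega>\<bar> \<le> 1"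
    and mean: "\<And>n i. i \<in> I n \<Longrightarrow> integral\<^sup>L (M n) (X n i) = 0"
  defines "v \<equiv> \<lambda>n. \<Sum>i\<in>I n. integral\<^sup>L (M n) (\<lambda>\<omega>. (X n i \<omega>)\<^sup>2)"
  assumes v: "filterlim v at_top sequentially"
  shows "weak_conv_m (\<lambda>n. distr (M n) borel (\<lambda>\<omega>. (\<Sum>i\<in>I n. X n i \<omega>) / sqrt (v n))) std_normal_distribution"
proof (rule levy_continuity)
  fix n
  interpret prob_space "M n" by (rule prob)
  have "X n i \<in> borel_measurable (M n)" if "i \<in> I n" for i
    using ind[of n] that by (auto simp: indep_vars_def2)
  thus "real_distribution (distr (M n) borel (\<lambda>\<omega>. (\<Sum>i\<in>I n. X n i \<omega>) / sqrt (v n)))"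
    by (intro real_distribution_distr borel_measurable_divide borel_measurable_sum) auto
next
  show "real_distribution std_normal_distribution" by (rule real_dist_normal_dist)
next
  fix t :: real
  let ?\<phi> = "\<lambda>n. char (distr (M n) borel (\<lambda>\<omega>. (\<Sum>i\<in>I n. X n i \<omega>) / sqrt (v n))) t"
  \<comment> \<open>Positivity of \<open>v n\<close> holds only from some index on; earlier members,
    where the quotient may be a division by zero, do not affect the limit.\<close>
  have ev: "\<forall>\<^sub>F n in sequentially. cmod (?\<phi> n - exp (- (t\<^sup>2 / 2))) \<le> \<bar>t\<bar> ^ 3 / (6 * sqrt (v n)) + t ^ 4 / (8 * v n)"
    using filterlim_at_top_dense[THEN iffD1, OF v, rule_format, of 0]
  proof eventually_elim
    case (elim n)
    interpret prob_space "M n" by (rule prob)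
    show ?case unfolding v_def
      by (rule char_bounded_sum_approx[OF fin ind bd mean]) (use elim in \<open>auto simp: v_def\<close>)
  qed
  have "((\<lambda>x. \<bar>t\<bar> ^ 3 / (6 * sqrt x) + t ^ 4 / (8 * x)) \<longlongrightarrow> 0) at_top"
    by (auto intro!: tendsto_add_zero tendsto_divide_0[OF tendsto_const] filterlim_at_top_imp_at_infinity
        filterlim_tendsto_pos_mult_at_top[OF tendsto_const] sqrt_at_top filterlim_ident)
  from filterlim_compose[OF this v] have "(\<lambda>n. \<bar>t\<bar> ^ 3 / (6 * sqrt (v n)) + t ^ 4 / (8 * v n)) \<longlonglongrightarrow> 0" .
  from Lim_null_comparison[OF ev this]
  have "(\<lambda>n. ?\<phi> n - exp (- (t\<^sup>2 / 2))) \<longlonglongrightarrow> 0" .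
  thus "?\<phi> \<longlonglongrightarrow> char std_normal_distribution t"
    by (simp add: char_std_normal_distribution LIM_zero_iff)
qed

section \<open>Random digits\<close>

text \<open>Horner's scheme with \<open>d 0\<close> as the leading digit, so that
  \<open>digits_val b d K / b ^ K\<close> is the expansion 0.d0 d1 d2 ... in base \<open>b\<close>,
  cut after \<open>K\<close> digits.\<close>

primrec digits_val :: "nat \<Rightarrow> (nat \<Rightarrow> nat) \<Rightarrow> nat \<Rightarrow> nat" where
  "digits_val b d 0 = 0"
| "digits_val b d (Suc K) = b * digits_val b d K + d K"

lemma digits_val_cong: "(\<And>k. k < K \<Longrightarrow> d k = d' k) \<Longrightarrow> digits_val b d K = digits_val b d' K"
  by (induction K) auto

lemma digits_val_less:
  assumes "\<And>k. k < K \<Longrightarrow> d k < b"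
  shows "digits_val b d K < b ^ K"
  using assms
proof (induction K)
  case (Suc K)
  have "b * digits_val b d K + d K < b * (digits_val b d K + 1)" using Suc.prems[of K] by simp
  also have "\<dots> \<le> b * b ^ K" using Suc by (intro mult_left_mono) (auto simp: Suc_le_eq)
  finally show ?case by simp
qed simp

lemma digits_val_eq_iff:
  assumes "\<And>k. k < K \<Longrightarrow> d k < b" "\<And>k. k < K \<Longrightarrow> d' k < b"
  shows "digits_val b d K = digits_val b d' K \<longleftrightarrow> (\<forall>k<K. d k = d' k)"
  using assms
proof (induction K)
  case (Suc K)
  have "d K < b" "d' K < b" using Suc.prems by auto
  moreover from this have "digits_val b d (Suc K) div b = digits_val b d K" "digits_val b d (Suc K) mod b = d K"
     "digits_val b d' (Suc K) div b = digits_val b d' K" "digits_val b d' (Suc K) mod b = d' K" by auto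
  ultimately have "digits_val b d (Suc K) = digits_val b d' (Suc K) \<longleftrightarrow> digits_val b d K = digits_val b d' K \<and> d K = d' K"
    by (metis digits_val.simps(2))
  with Suc show ?case by (auto simp: less_Suc_eq)
qed simp

lemma digits_val_surj:
  assumes "b > 0" "t < b ^ K"
  obtains d where "\<And>k. d k < b" "digits_val b d K = t"
proof -
  from assms(2) have "\<exists>d. (\<forall>k. d k < b) \<and> digits_val b d K = t"
  proof (induction K arbitrary: t)
    case 0 with \<open>b > 0\<close> show ?case by (intro exI[of _ "\<lambda>_. 0"]) simp
  next
    case (Suc K)
    have "t div b < b ^ K" using Suc.prems by (simp add: less_mult_imp_div_less mult.commute)
    from Suc.IH[OF this] obtain d where d: "\<forall>k. d k < b" "digits_val b d K = t div b" by blast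
    have "digits_val b (d(K := t mod b)) (Suc K) = b * digits_val b d K + t mod b"
      using digits_val_cong[of K "d(K := t mod b)" d b] by simp
    also have "\<dots> = t" using d by simp
    finally have "digits_val b (d(K := t mod b)) (Suc K) = t" .
    moreover have "\<forall>k. (d(K := t mod b)) k < b" using d \<open>b > 0\<close> by simp
    ultimately show ?case by blast
  qed
  with that show ?thesis by blast
qed

section \<open>Base-\<open>b\<close> expansions as real numbers\<close>

context
  fixes b :: nat and d :: "nat \<Rightarrow> nat"
  assumes b: "b \<ge> 2" and d: "\<And>k. d k < b"
begin

lemma sum_digits: "(\<Sum>k<K. real (d k) / real b ^ Suc k) = real (digits_val b d K) / real b ^ K"
  using b by (induction K) (simp_all add: field_simps)

text \<open>Appending digits never leaves the b-adic interval fixed by the first \<open>K\<close>.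
  The added 1 on both sides closes the induction: a digit is at most \<open>b - 1\<close>, so one
  more digit multiplies the left side by at most \<open>b\<close>.\<close>

lemma digits_val_Suc_le: "digits_val b d (K + L) + 1 \<le> (digits_val b d K + 1) * b ^ L"
proof (induction L)
  case (Suc L)
  have "digits_val b d (K + Suc L) + 1 \<le> b * (digits_val b d (K + L) + 1)" using d[of "K + L"] by simp
  also have "\<dots> \<le> b * ((digits_val b d K + 1) * b ^ L)" using Suc by (rule mult_left_mono) simp
  finally show ?case by (simp only: power_Suc ac_simps)
qed simp

lemma sum_digits_le: "(\<Sum>k<N. real (d k) / real b ^ Suc k) \<le> (real (digits_val b d K) + 1) / real b ^ K"
proof -
  \<comment> \<open>Nothing orders \<open>N\<close> and \<open>K\<close>, so the sum is padded with
    nonnegative terms to length \<open>K + N\<close>.\<close>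
  have "(\<Sum>k<N. real (d k) / real b ^ Suc k) \<le> (\<Sum>k<K+N. real (d k) / real b ^ Suc k)"
    by (rule sum_mono2) auto
  also have "\<dots> \<le> real (digits_val b d (K + N) + 1) / real b ^ (K + N)"
    unfolding sum_digits by (intro divide_right_mono) auto
  also have "\<dots> \<le> real ((digits_val b d K + 1) * b ^ N) / real b ^ (K + N)"
    by (intro divide_right_mono of_nat_mono digits_val_Suc_le) auto
  also have "\<dots> = (real (digits_val b d K) + 1) / real b ^ K"
    using b by (simp add: field_simps power_add)
  finally show ?thesis .
qed

text \<open>The case \<open>K = 0\<close> of the preceding bound says that all partial sums are at
  most 1.\<close>

lemma summable_digits: "summable (\<lambda>k. real (d k) / real b ^ Suc k)"
  by (rule summableI_nonneg_bounded[OF _ sum_digits_le[of _ 0]]) simp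

lemma suminf_digits_le: "(\<Sum>k. real (d k) / real b ^ Suc k) \<le> (real (digits_val b d K) + 1) / real b ^ K"
  by (rule suminf_le_const[OF summable_digits sum_digits_le])

lemma suminf_digits_ge: "real (digits_val b d K) / real b ^ K \<le> (\<Sum>k. real (d k) / real b ^ Suc k)"
  unfolding sum_digits[symmetric] by (rule sum_le_suminf[OF summable_digits]) auto

lemma suminf_digits_split:
  "(\<Sum>k. real (d k) / real b ^ Suc k)
    = (real (digits_val b d K) + (\<Sum>k. real (d (K + k)) / real b ^ Suc k)) / real b ^ K"
proof -
  have s: "summable (\<lambda>k. real (d (k + K)) / real b ^ Suc (k + K))"
    using summable_ignore_initial_segment[OF summable_digits, of K] .
  have "(\<Sum>k. real (d (K + k)) / real b ^ Suc k) = (\<Sum>k. real b ^ K * (real (d (k + K)) / real b ^ Suc (k + K)))"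
    using b by (intro suminf_cong) (simp add: field_simps power_add)
  also have "\<dots> = real b ^ K * (\<Sum>k. real (d (k + K)) / real b ^ Suc (k + K))"
    using s by (rule suminf_mult)
  finally show ?thesis
    using b suminf_split_initial_segment[OF summable_digits, of K] unfolding sum_digits
    by (simp add: add_divide_distrib)
qed

end

text \<open>The number \<open>T K\<close> formed by the first \<open>K\<close> digits is uniform on
  the integers below \<open>b ^ K\<close>, and the sum lies between \<open>T K / b ^ K\<close> and
  \<open>(T K + 1) / b ^ K\<close>. Counting integers then gives the distribution function at
  \<open>x\<close> up to \<open>b\<close> to the power \<open>- K\<close>, for every
  \<open>K\<close>, hence exactly.\<close>

lemma (in prob_space) distr_uniform_digits:
  fixes D :: "nat \<Rightarrow> 'a \<Rightarrow> nat"
  assumes b: "b \<ge> 2"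
    and ind: "indep_vars (\<lambda>_. count_space UNIV) D UNIV"
    and range: "\<And>k \<omega>. \<omega> \<in> space M \<Longrightarrow> D k \<omega> < b"
    and unif: "\<And>k e. e < b \<Longrightarrow> prob (D k -` {e} \<inter> space M) = 1 / real b"
  shows "distr M borel (\<lambda>\<omega>. \<Sum>k. real (D k \<omega>) / real b ^ Suc k) = uniform_measure lborel {0..1}"
    (is "distr M borel ?U = _")
proof -
  have D[measurable]: "D k \<in> measurable M (count_space UNIV)" for k
    using ind by (auto simp: indep_vars_def2)
  define T where "T K \<omega> = digits_val b (\<lambda>k. D k \<omega>) K" for K \<omega>
  have T[measurable]: "T K \<in> measurable M (count_space UNIV)" for K
    unfolding T_def by (induction K) auto
  have U[measurable]: "?U \<in> borel_measurable M" by measurable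
  have T1: "prob (T K -` {t} \<inter> space M) = 1 / real b ^ K" if t: "t < b ^ K" for K t
  \<comment> \<open>For \<open>K = 0\<close> the intersection of digit events used below would be
    \<open>UNIV\<close> instead of the sample space.\<close>
  proof (cases "K = 0")
    case True
    with t have "T K -` {t} \<inter> space M = space M" by (auto simp: T_def)
    with True show ?thesis by (simp add: prob_space)
  next
    case False
    have "b > 0" using b by simp
    from digits_val_surj[OF this t] obtain d where d: "\<And>k. d k < b" "digits_val b d K = t" by metis
    have "T K \<omega> = t \<longleftrightarrow> (\<forall>k<K. D k \<omega> = d k)" if "\<omega> \<in> space M" for \<omega>
      unfolding T_def d(2)[symmetric] using range[OF that] d(1) by (intro digits_val_eq_iff) auto
    hence "T K -` {t} \<inter> space M = (\<Inter>k\<in>{..<K}. D k -` {d k} \<inter> space M)"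
      using False by auto
    also have "prob \<dots> = (\<Prod>k<K. prob (D k -` {d k} \<inter> space M))"
      by (rule indep_varsD[OF ind]) (use False in auto)
    also have "\<dots> = 1 / real b ^ K" using unif d by (simp add: prod_constant power_one_over)
    finally show ?thesis .
  qed
  have TA: "prob {\<omega>\<in>space M. T K \<omega> \<in> A} = real (card A) / real b ^ K" if A: "A \<subseteq> {..<b ^ K}" for K A
  proof -
    have fin: "finite A" using A by (rule finite_subset) simp
    have "{\<omega>\<in>space M. T K \<omega> \<in> A} = (\<Union>t\<in>A. T K -` {t} \<inter> space M)" by auto
    also have "prob \<dots> = (\<Sum>t\<in>A. prob (T K -` {t} \<inter> space M))"
      by (rule finite_measure_finite_Union[OF fin]) (auto simp: disjoint_family_on_def)
    also have "\<dots> = (\<Sum>t\<in>A. 1 / real b ^ K)" using A T1 by (intro sum.cong) auto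
    finally show ?thesis by simp
  qed
  have Tlt: "T K \<omega> < b ^ K" if "\<omega> \<in> space M" for K \<omega>
    unfolding T_def using range[OF that] by (intro digits_val_less)
  have Ule: "?U \<omega> \<le> (real (T K \<omega>) + 1) / real b ^ K" "real (T K \<omega>) / real b ^ K \<le> ?U \<omega>" if "\<omega> \<in> space M" for \<omega> K
    unfolding T_def using suminf_digits_le[of b "\<lambda>k. D k \<omega>"] suminf_digits_ge[of b "\<lambda>k. D k \<omega>"] b range[OF that] by auto
  have U0: "0 \<le> ?U \<omega>" "?U \<omega> \<le> 1" if "\<omega> \<in> space M" for \<omega>
    using Ule[OF that, of 0] by (auto simp: T_def)
  have P: "prob {\<omega>\<in>space M. ?U \<omega> \<le> x} = x" if x: "0 \<le> x" "x \<le> 1" for x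
  proof -
    have bd: "\<bar>prob {\<omega>\<in>space M. ?U \<omega> \<le> x} - x\<bar> \<le> (1 / real b) ^ K" for K
    proof -
      define y where "y = x * real b ^ K"
      have bK: "real b ^ K > 0" using b by simp
      have y: "0 \<le> y" "y \<le> real b ^ K" using x bK by (auto simp: y_def mult_left_le_one_le)
      \<comment> \<open>The event that the sum is at most \<open>x\<close> is contained in
        \<open>T K \<in> ?A\<close> and contains \<open>T K \<in> ?B\<close>. The two sets have at
        most \<open>y + 1\<close> and at least \<open>y - 1\<close> elements, whence the error of
        one grid step.\<close>
      let ?A = "{t. t < b ^ K \<and> real t \<le> y}" and ?B = "{t. real t + 1 \<le> y}"
      have "prob {\<omega>\<in>space M. ?U \<omega> \<le> x} \<le> prob {\<omega>\<in>space M. T K \<omega> \<in> ?A}"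
      proof (rule finite_measure_mono)
        show "{\<omega>\<in>space M. ?U \<omega> \<le> x} \<subseteq> {\<omega>\<in>space M. T K \<omega> \<in> ?A}"
        proof safe
          fix \<omega> assume w: "\<omega> \<in> space M" and le: "?U \<omega> \<le> x"
          show "T K \<omega> < b ^ K" by (rule Tlt[OF w])
          have "real (T K \<omega>) / real b ^ K \<le> x" using Ule(2)[OF w, of K] le by linarith
          thus "real (T K \<omega>) \<le> y" using bK by (simp add: y_def divide_le_eq)
        qed
      qed measurable
      also have "\<dots> = real (card ?A) / real b ^ K" by (rule TA) auto
      also have "card ?A \<le> card {..nat \<lfloor>y\<rfloor>}"
        by (rule card_mono) (use y in \<open>auto simp: le_nat_floor\<close>)
      also have "real (card {..nat \<lfloor>y\<rfloor>}) \<le> y + 1" using y by simp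
      finally have 1: "prob {\<omega>\<in>space M. ?U \<omega> \<le> x} \<le> (y + 1) / real b ^ K"
        using bK by (simp add: divide_right_mono)
      have Bsub: "?B \<subseteq> {..<b ^ K}"
      proof
        fix t assume "t \<in> ?B"
        hence "real t < real b ^ K" using y(2) unfolding mem_Collect_eq by linarith
        hence "real t < real (b ^ K)" by simp
        thus "t \<in> {..<b ^ K}" by (simp only: of_nat_less_iff lessThan_iff)
      qed
      have "{..<nat \<lfloor>y\<rfloor>} \<subseteq> ?B" using y by auto linarith
      hence "card {..<nat \<lfloor>y\<rfloor>} \<le> card ?B" by (intro card_mono finite_subset[OF Bsub]) auto
      hence "y - 1 \<le> real (card ?B)" using y by simp linarith
      hence "(y - 1) / real b ^ K \<le> real (card ?B) / real b ^ K" using bK by (intro divide_right_mono) auto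
      also have "\<dots> = prob {\<omega>\<in>space M. T K \<omega> \<in> ?B}" by (rule TA[OF Bsub, symmetric])
      also have "\<dots> \<le> prob {\<omega>\<in>space M. ?U \<omega> \<le> x}"
      proof (rule finite_measure_mono)
        show "{\<omega>\<in>space M. T K \<omega> \<in> ?B} \<subseteq> {\<omega>\<in>space M. ?U \<omega> \<le> x}"
        proof safe
          fix \<omega> assume w: "\<omega> \<in> space M" and "real (T K \<omega>) + 1 \<le> y"
          hence "(real (T K \<omega>) + 1) / real b ^ K \<le> x" using bK by (simp add: y_def divide_le_eq)
          with Ule(1)[OF w, of K] show "?U \<omega> \<le> x" by linarith
        qed
      qed measurable
      finally have 2: "(y - 1) / real b ^ K \<le> prob {\<omega>\<in>space M. ?U \<omega> \<le> x}" .
      have "y / real b ^ K = x" using bK by (simp add: y_def)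
      with 1 2 show ?thesis by (simp add: add_divide_distrib diff_divide_distrib power_one_over)
    qed
    \<comment> \<open>The quantity bounded in \<open>bd\<close> does not depend on \<open>K\<close>,
      so the bound may be passed to the limit.\<close>
    have "(\<lambda>K. (1 / real b) ^ K) \<longlonglongrightarrow> 0" using b by (intro LIMSEQ_realpow_zero) auto
    hence "\<bar>prob {\<omega>\<in>space M. ?U \<omega> \<le> x} - x\<bar> \<le> 0"
      by (rule LIMSEQ_le_const) (use bd in auto)
    thus ?thesis by simp
  qed
  interpret L: prob_space "uniform_measure lborel {0..1::real}"
    by (rule prob_space_uniform_measure) auto
  show ?thesis
  proof (rule cdf_unique)
    show "real_distribution (distr M borel ?U)" by (rule real_distribution_distr) measurable
    show "real_distribution (uniform_measure lborel {0..1::real})"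
      by standard (auto simp: sets_eq_imp_space_eq)
    show "cdf (distr M borel ?U) = cdf (uniform_measure lborel {0..1})"
    proof
      fix x :: real
      have l: "cdf (distr M borel ?U) x = prob {\<omega>\<in>space M. ?U \<omega> \<le> x}"
        by (simp add: cdf_def measure_distr vimage_def Int_def conj_commute)
      have r: "cdf (uniform_measure lborel {0..1}) x = measure lborel ({0..1} \<inter> {..x})"
        by (simp add: cdf_def)
      consider "x < 0" | "0 \<le> x" "x \<le> 1" | "x > 1" by linarith
      thus "cdf (distr M borel ?U) x = cdf (uniform_measure lborel {0..1}) x"
      proof cases
        case 1
        have e: "{\<omega>\<in>space M. ?U \<omega> \<le> x} = {}" using U0 1 by force
        have e': "{0..1} \<inter> {..x} = {}" using 1 by auto
        show ?thesis unfolding l r e e' by simp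
      next
        case 2
        have e: "{0..1} \<inter> {..x} = {0..x}" using 2 by auto
        show ?thesis unfolding l r P[OF 2] e using 2 by simp
      next
        case 3
        have e: "{\<omega>\<in>space M. ?U \<omega> \<le> x} = space M" using U0 3 by force
        have e': "{0..1} \<inter> {..x} = {0..1}" using 3 by auto
        show ?thesis unfolding l r e e' by (simp add: prob_space)
      qed
    qed
  qed
qed

section \<open>Scrambled points\<close>

text \<open>Composition with the transposition of \<open>y\<close> and \<open>z\<close> is an
  involution that exchanges the permutations sending \<open>x\<close> to \<open>z\<close> with those
  sending \<open>x\<close> to \<open>y\<close>. So the classes according to the image of
  \<open>x\<close> all have the same size.\<close>

lemma card_permutes_at:
  assumes "finite A" "x \<in> A" "y \<in> A"
  shows "card A * card {p. p permutes A \<and> p x = y} = card {p. p permutes A}"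
proof -
  have fin: "finite {p. p permutes A \<and> p x = z}" for z
    by (rule finite_subset[OF _ finite_permutations[OF assms(1)]]) auto
  have eq: "card {p. p permutes A \<and> p x = z} = card {p. p permutes A \<and> p x = y}" if "z \<in> A" for z
  proof (rule bij_betw_same_card[OF bij_betw_byWitness[where f = "\<lambda>p. Transposition.transpose y z \<circ> p" and f' = "\<lambda>p. Transposition.transpose y z \<circ> p"]])
  qed (use assms that in \<open>auto simp flip: o_assoc intro!: permutes_compose permutes_swap_id\<close>)
  have "{p. p permutes A} = (\<Union>z\<in>A. {p. p permutes A \<and> p x = z})"
    using permutes_in_image[of _ A x] assms(2) by auto
  also have "card \<dots> = (\<Sum>z\<in>A. card {p. p permutes A \<and> p x = z})"
    by (rule card_UN_disjoint[OF assms(1)]) (use fin in auto)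
  also have "\<dots> = (\<Sum>z\<in>A. card {p. p permutes A \<and> p x = y})" by (rule sum.cong[OF refl eq])
  finally show ?thesis by simp
qed

section \<open>Recovering an index from its digits and prefixes\<close>

lemma digits_eq_mod:
  assumes "\<And>j. j \<in> {1..m} \<Longrightarrow> digit b i j = digit b i' j"
  shows "(i - 1) mod b ^ m = (i' - 1) mod b ^ m"
  using assms
proof (induction m)
  case (Suc m)
  have "(i - 1) div b ^ m mod b = (i' - 1) div b ^ m mod b"
    using Suc.prems[of "Suc m"] by (simp add: digit_def)
  with Suc show ?case by (simp add: mod_mult2_eq mult.commute[of b])
qed simp

text \<open>On this index range \<open>i - 1\<close> is below \<open>b ^ m\<close>, hence equal to
  its own residue, and \<open>i \<ge> 1\<close> keeps the truncated subtraction injective.\<close>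

lemma digits_eq_imp_eq:
  assumes "i \<in> {1..b ^ m}" "i' \<in> {1..b ^ m}" "\<And>j. j \<in> {1..m} \<Longrightarrow> digit b i j = digit b i' j"
  shows "i = i'"
  using digits_eq_mod[OF assms(3), of m] assms(1,2) by auto

text \<open>The label of the permutation that scrambles digit \<open>j + 1\<close>. It consists of
  unscrambled digits, hence is deterministic, and its length \<open>j\<close> separates the levels
  of the tree of permutations.\<close>

definition digit_prefix :: "nat \<Rightarrow> nat \<Rightarrow> nat \<Rightarrow> nat list" where
  "digit_prefix b i j = map (digit b i) [1..<Suc j]"

lemma length_digit_prefix [simp]: "length (digit_prefix b i j) = j"
  by (simp add: digit_prefix_def)

lemma scr_digit_Suc: "scr_digit b \<omega> i (Suc j) = \<omega> (digit_prefix b i j) (digit b i (Suc j))"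
  by (simp add: scr_digit_def digit_prefix_def)

text \<open>Source of the independence of the tails: equal lists have equal length and agree in the
  first \<open>m\<close> digits, which determine the index. From level \<open>m\<close> on,
  different points therefore never share a permutation.\<close>

lemma digit_prefix_eq_imp_eq:
  assumes "i \<in> {1..b ^ m}" "i' \<in> {1..b ^ m}" "m \<le> j" "digit_prefix b i j = digit_prefix b i' j'"
  shows "i = i'"
proof (rule digits_eq_imp_eq[OF assms(1,2)])
  have "j = j'" using arg_cong[OF assms(4), of length] by simp
  fix k assume "k \<in> {1..m}"
  hence "k \<in> set [1..<Suc j]" using assms(3) by auto
  with assms(4) show "digit b i k = digit b i' k"
    unfolding digit_prefix_def \<open>j = j'\<close>[symmetric] map_eq_conv by blast
qed

text \<open>Cells are counted from 0 here, so the value \<open>k\<close> belongs to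
  \<open>cell H (b ^ m) (Suc k)\<close>.\<close>

definition scr_cell :: "nat \<Rightarrow> nat \<Rightarrow> nat \<Rightarrow> (nat list \<Rightarrow> nat \<Rightarrow> nat) \<Rightarrow> nat" where
  "scr_cell b m i \<omega> = digits_val b (\<lambda>k. scr_digit b \<omega> i (Suc k)) m"

text \<open>The digits after the first \<open>m\<close>, magnified by \<open>b ^ m\<close>, so that
  they give the relative position in the cell, a number in the closed unit interval.\<close>

definition scr_tail :: "nat \<Rightarrow> nat \<Rightarrow> nat \<Rightarrow> (nat list \<Rightarrow> nat \<Rightarrow> nat) \<Rightarrow> real" where
  "scr_tail b m i \<omega> = (\<Sum>k. real (scr_digit b \<omega> i (Suc (m + k))) / real b ^ Suc k)"

text \<open>The relative position, within the \<open>k\<close>-th cell of length \<open>1 / b ^ m\<close> (counted from \<open>0\<close>), of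
  the scrambled point falling into it: on the sample space exactly one summand is selected.\<close>
definition cell_pos :: "nat \<Rightarrow> nat \<Rightarrow> nat \<Rightarrow> (nat list \<Rightarrow> nat \<Rightarrow> nat) \<Rightarrow> real" where
  "cell_pos b m k \<omega> = (\<Sum>i = 1..b ^ m. if scr_cell b m i \<omega> = k then scr_tail b m i \<omega> else 0)"

context
  fixes b :: nat
  assumes b: "b \<ge> 2"
begin

section \<open>The product space of permutations and independence of its coordinates\<close>

abbreviation perm_measure where "perm_measure \<equiv> uniform_count_measure {p. p permutes {0..<b}}"
abbreviation scr_measure where "scr_measure \<equiv> PiM (UNIV :: nat list set) (\<lambda>_. perm_measure)"

lemma prob_space_perm_measure: "prob_space perm_measure"
  by (rule prob_space_uniform_count_measure) (auto intro: finite_permutations permutes_id)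

lemma prob_space_scr_measure: "prob_space scr_measure"
  by (rule prob_space_PiM) (rule prob_space_perm_measure)

lemma digit_less: "digit b i j < b"
  using b by (simp add: digit_def)

lemma measure_perm_at:
  assumes "x < b" "y < b"
  shows "measure perm_measure {p \<in> space perm_measure. p x = y} = 1 / real b"
proof -
  have "measure perm_measure {p \<in> space perm_measure. p x = y}
    = card {p. p permutes {0..<b} \<and> p x = y} / card {p. p permutes {0..<b}}"
    unfolding space_uniform_count_measure
    by (subst measure_uniform_count_measure) (auto intro: finite_permutations)
  moreover have "real (card {p. p permutes {0..<b}}) = real b * real (card {p. p permutes {0..<b} \<and> p x = y})"
    using card_permutes_at[of "{0..<b}" x y] assms by (simp flip: of_nat_mult)
  moreover have "card {p. p permutes {0..<b}} > 0"
    using assms by (simp add: card_permutations[of "{0..<b}" b])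
  ultimately show ?thesis by (auto simp: field_simps)
qed

lemma in_space_permutes: "\<omega> \<in> space scr_measure \<Longrightarrow> \<omega> l permutes {0..<b}"
  by (auto simp: space_PiM space_uniform_count_measure)

lemma scr_digit_less: "\<omega> \<in> space scr_measure \<Longrightarrow> scr_digit b \<omega> i j < b"
  using permutes_in_image[OF in_space_permutes] digit_less unfolding scr_digit_def
  by (metis atLeastLessThan_iff le0)

text \<open>Every subset of the finite space of permutations is measurable. The index set
  \<open>L\<close> is left general because independence of blocks requires measurability with
  respect to the coordinates of one block only.\<close>

lemma measurable_coordinate_at [measurable (raw)]:
  "l \<in> L \<Longrightarrow> (\<lambda>\<omega>. \<omega> l x) \<in> measurable (PiM L (\<lambda>_. perm_measure)) (count_space UNIV)"
  by (rule measurable_compose[OF measurable_component_singleton[of l L]])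
     (auto simp: measurable_def sets_uniform_count_measure space_uniform_count_measure)

lemma measurable_scr_tail':
  assumes "\<And>k. digit_prefix b i (m + k) \<in> L"
  shows "scr_tail b m i \<in> borel_measurable (PiM L (\<lambda>_. perm_measure))"
  unfolding scr_tail_def[abs_def] scr_digit_Suc
  by (intro borel_measurable_suminf borel_measurable_divide measurable_compose[OF measurable_coordinate_at[OF assms]]) auto

lemma measurable_scr_cell':
  assumes "\<And>k. k < m \<Longrightarrow> digit_prefix b i k \<in> L"
  shows "scr_cell b m i \<in> measurable (PiM L (\<lambda>_. perm_measure)) (count_space UNIV)"
  using assms unfolding scr_cell_def[abs_def] scr_digit_Suc
proof (induction m)
  case (Suc m)
  have lin: "(\<lambda>\<omega>. b * f \<omega> + g \<omega>) \<in> measurable N (count_space UNIV)"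
    if [measurable]: "f \<in> measurable N (count_space UNIV)" "g \<in> measurable N (count_space UNIV)"
    for f g and N :: "(nat list \<Rightarrow> nat \<Rightarrow> nat) measure"
    by measurable
  show ?case unfolding digits_val.simps
    by (rule lin[OF Suc.IH measurable_coordinate_at]) (use Suc.prems in auto)
qed simp

lemmas measurable_scr_tail [measurable] = measurable_scr_tail'[OF UNIV_I]
lemmas measurable_scr_cell [measurable] = measurable_scr_cell'[OF UNIV_I]

lemma measurable_cell_pos [measurable]: "cell_pos b m k \<in> borel_measurable scr_measure"
  unfolding cell_pos_def[abs_def] by measurable

lemma indep_coordinates: "prob_space.indep_vars scr_measure (\<lambda>_. perm_measure) (\<lambda>l \<omega>. \<omega> l) UNIV"
proof -
  interpret prob_space scr_measure by (rule prob_space_scr_measure)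
  have "distr scr_measure perm_measure (\<lambda>\<omega>. \<omega> l) = perm_measure" for l
    by (rule distr_PiM_component) (auto intro: prob_space_perm_measure)
  thus ?thesis
    by (subst indep_vars_iff_distr_eq_PiM) (auto simp: restrict_UNIV)
qed

text \<open>The last hypothesis says that \<open>Y i\<close> reads only the coordinates in
  \<open>K i\<close>, as \<open>restrict\<close> erases all others; so each \<open>Y i\<close> is a
  function of its own block, and disjoint blocks are independent.\<close>

lemma indep_disjoint_coordinates:
  assumes "disjoint_family_on K L" "\<And>i. i \<in> L \<Longrightarrow> Y i \<in> measurable (PiM (K i) (\<lambda>_. perm_measure)) (N i)"
    and "\<And>i \<omega>. i \<in> L \<Longrightarrow> Y i (restrict \<omega> (K i)) = Y i \<omega>"
  shows "prob_space.indep_vars scr_measure N Y L"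
proof -
  interpret prob_space scr_measure by (rule prob_space_scr_measure)
  have "indep_vars N (\<lambda>i \<omega>. Y i (restrict \<omega> (K i))) L"
    by (rule indep_vars_compose2[OF indep_vars_restrict[OF indep_coordinates _ assms(1)] assms(2)]) auto
  thus ?thesis using assms(3) by (subst (asm) indep_vars_cong[OF refl, of _ _ Y]) auto
qed

text \<open>The digits of one tail use prefixes of pairwise different lengths, hence different
  coordinates, and are independent. Each is a uniform permutation evaluated at a fixed argument,
  hence uniform.\<close>

lemma distr_scr_tail:
  "distr scr_measure borel (scr_tail b m i) = uniform_measure lborel {0..1}"
proof -
  interpret prob_space scr_measure by (rule prob_space_scr_measure)
  show ?thesis unfolding scr_tail_def[abs_def]
  proof (rule distr_uniform_digits[OF b])
    show "indep_vars (\<lambda>_. count_space UNIV) (\<lambda>k \<omega>. scr_digit b \<omega> i (Suc (m + k))) UNIV"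
      unfolding scr_digit_Suc
      by (rule indep_disjoint_coordinates[where K = "\<lambda>k. {digit_prefix b i (m + k)}"])
         (auto simp: disjoint_family_on_def dest: arg_cong[where f = length])
    fix k e assume "e < b"
    let ?l = "digit_prefix b i (m + k)" and ?x = "digit b i (Suc (m + k))"
    have d: "distr scr_measure perm_measure (\<lambda>\<omega>. \<omega> ?l) = perm_measure"
      by (rule distr_PiM_component) (auto intro: prob_space_perm_measure)
    have "1 / real b = measure (distr scr_measure perm_measure (\<lambda>\<omega>. \<omega> ?l)) {p \<in> space perm_measure. p ?x = e}"
      unfolding d by (rule measure_perm_at[OF digit_less \<open>e < b\<close>, symmetric])
    also have "\<dots> = prob ((\<lambda>\<omega>. \<omega> ?l) -` {p \<in> space perm_measure. p ?x = e} \<inter> space scr_measure)"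
      by (rule measure_distr) (auto simp: sets_uniform_count_measure space_uniform_count_measure)
    also have "(\<lambda>\<omega>. \<omega> ?l) -` {p \<in> space perm_measure. p ?x = e} \<inter> space scr_measure
      = (\<lambda>\<omega>. scr_digit b \<omega> i (Suc (m + k))) -` {e} \<inter> space scr_measure"
      by (auto simp: scr_digit_Suc space_PiM)
    finally show "prob ((\<lambda>\<omega>. scr_digit b \<omega> i (Suc (m + k))) -` {e} \<inter> space scr_measure) = 1 / real b" ..
  qed (rule scr_digit_less)
qed

section \<open>Relabelling the points by the cells they enter\<close>

lemma scr_point_eq:
  assumes "\<omega> \<in> space scr_measure"
  shows "scr_point b \<omega> i = (real (scr_cell b m i \<omega>) + scr_tail b m i \<omega>) / real (b ^ m)"
  using suminf_digits_split[OF b, of "\<lambda>k. scr_digit b \<omega> i (Suc k)" m] scr_digit_less[OF assms]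
  by (simp add: scr_point_def scr_cell_def scr_tail_def)

text \<open>Scrambling can be undone from the leading digit on: as long as the original prefixes
  agree, both points use the same permutation, and its injectivity transfers equality to the next
  original digit.\<close>

lemma scr_cell_eq_imp_eq:
  assumes w: "\<omega> \<in> space scr_measure" and i: "i \<in> {1..b ^ m}" "i' \<in> {1..b ^ m}"
    and eq: "scr_cell b m i \<omega> = scr_cell b m i' \<omega>"
  shows "i = i'"
proof (rule digits_eq_imp_eq[OF i])
  have *: "\<forall>k<m. scr_digit b \<omega> i (Suc k) = scr_digit b \<omega> i' (Suc k)"
    using eq scr_digit_less[OF w] unfolding scr_cell_def by (subst (asm) digits_val_eq_iff) auto
  have "k \<le> m \<Longrightarrow> \<forall>j\<in>{1..k}. digit b i j = digit b i' j" for k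
  proof (induction k)
    case (Suc k)
    have "digit_prefix b i k = digit_prefix b i' k"
      using Suc by (auto simp: digit_prefix_def)
    moreover have "scr_digit b \<omega> i (Suc k) = scr_digit b \<omega> i' (Suc k)" using * Suc.prems by simp
    ultimately have "digit b i (Suc k) = digit b i' (Suc k)"
      unfolding scr_digit_Suc using permutes_inj[OF in_space_permutes[OF w]] by (metis injD)
    with Suc show ?case by (auto simp: le_Suc_eq)
  qed simp
  thus "digit b i j = digit b i' j" if "j \<in> {1..m}" for j using that by blast
qed

lemma bij_betw_scr_cell:
  assumes w: "\<omega> \<in> space scr_measure"
  shows "bij_betw (\<lambda>i. scr_cell b m i \<omega>) {1..b ^ m} {..<b ^ m}"
proof -
  have inj: "inj_on (\<lambda>i. scr_cell b m i \<omega>) {1..b ^ m}"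
    using scr_cell_eq_imp_eq[OF w] by (auto intro!: inj_onI)
  have sub: "(\<lambda>i. scr_cell b m i \<omega>) ` {1..b ^ m} \<subseteq> {..<b ^ m}"
    unfolding scr_cell_def using digits_val_less[of m _ b] scr_digit_less[OF w] by auto
  have "(\<lambda>i. scr_cell b m i \<omega>) ` {1..b ^ m} = {..<b ^ m}"
    by (rule card_subset_eq[OF _ sub]) (use card_image[OF inj] in simp_all)
  with inj show ?thesis by (simp add: bij_betw_def)
qed

lemma cell_pos_scr_cell:
  assumes w: "\<omega> \<in> space scr_measure" and i: "i \<in> {1..b ^ m}"
  shows "cell_pos b m (scr_cell b m i \<omega>) \<omega> = scr_tail b m i \<omega>"
proof -
  have "cell_pos b m (scr_cell b m i \<omega>) \<omega> = (\<Sum>i' = 1..b ^ m. if i' = i then scr_tail b m i' \<omega> else 0)"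
    unfolding cell_pos_def using scr_cell_eq_imp_eq[OF w] i by (intro sum.cong) auto
  thus ?thesis using i by simp
qed

text \<open>A pathwise reordering of the sum: it exchanges points with a random cell for positions
  in fixed cells, whose joint law is computed below.\<close>

lemma sum_scr_point:
  assumes w: "\<omega> \<in> space scr_measure"
  shows "(\<Sum>i = 1..b ^ m. F (scr_point b \<omega> i)) = (\<Sum>k<b ^ m. F ((real k + cell_pos b m k \<omega>) / real (b ^ m)))"
proof -
  have "(\<Sum>k<b ^ m. F ((real k + cell_pos b m k \<omega>) / real (b ^ m)))
    = (\<Sum>i = 1..b ^ m. F ((real (scr_cell b m i \<omega>) + cell_pos b m (scr_cell b m i \<omega>) \<omega>) / real (b ^ m)))"
    by (rule sum.reindex_bij_betw[OF bij_betw_scr_cell[OF w], symmetric])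
  also have "\<dots> = (\<Sum>i = 1..b ^ m. F (scr_point b \<omega> i))"
    by (intro sum.cong refl) (simp add: cell_pos_scr_cell[OF w] scr_point_eq[OF w, of _ m])
  finally show ?thesis ..
qed

text \<open>\<open>E\<close> is one possible outcome of the assignment. It involves only prefixes
  shorter than \<open>m\<close>, whereas the tail of a point involves prefixes of length at least
  \<open>m\<close> that begin with the first \<open>m\<close> digits of that point; all these blocks
  are disjoint.\<close>

lemma indep_scr_cell_tail:
  fixes s :: "nat \<Rightarrow> nat" and m :: nat
  defines "E \<equiv> {\<omega> \<in> space scr_measure. \<forall>i\<in>{1..b ^ m}. scr_cell b m i \<omega> = s i}"
  assumes A: "\<And>i. i \<in> {1..b ^ m} \<Longrightarrow> A i \<in> sets borel"
  shows "measure scr_measure {\<omega> \<in> E. \<forall>i\<in>{1..b ^ m}. scr_tail b m i \<omega> \<in> A i}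
    = measure scr_measure E * (\<Prod>i = 1..b ^ m. measure (uniform_measure lborel {0..1}) (A i))"
proof -
  interpret prob_space scr_measure by (rule prob_space_scr_measure)
  \<comment> \<open>The spare index 0 carries the indicator of \<open>E\<close>, and the positive
    indices carry the tails, so that a single independence statement covers both.\<close>
  define Z where "Z i = (if i = 0 then (\<lambda>\<omega>. if \<forall>i\<in>{1..b ^ m}. scr_cell b m i \<omega> = s i then 1 else 0) else scr_tail b m i)" for i
  define K where "K i = (if i = 0 then {l. length l < m} else range (\<lambda>k. digit_prefix b i (m + k)))" for i
  have cell_restrict: "scr_cell b m i (restrict \<omega> (K 0)) = scr_cell b m i \<omega>" for i \<omega>
    unfolding scr_cell_def by (rule digits_val_cong) (simp add: scr_digit_Suc K_def)
  have [measurable]: "scr_cell b m i \<in> measurable (PiM (K 0) (\<lambda>_. perm_measure)) (count_space UNIV)" for i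
    by (rule measurable_scr_cell') (simp add: K_def)
  have ind: "indep_vars (\<lambda>_. borel) Z {0..b ^ m}"
  proof (rule indep_disjoint_coordinates[where K = K])
    show "disjoint_family_on K {0..b ^ m}"
      unfolding disjoint_family_on_def
    proof (intro ballI impI)
      fix i j assume ij: "i \<in> {0..b ^ m}" "j \<in> {0..b ^ m}" "i \<noteq> j"
      show "K i \<inter> K j = {}"
      proof (cases "i = 0 \<or> j = 0")
        case True
        with ij show ?thesis by (auto simp: K_def)
      next
        case False
        with ij digit_prefix_eq_imp_eq[of i b m j] show ?thesis by (fastforce simp: K_def)
      qed
    qed
    fix i assume "i \<in> {0..b ^ m}"
    show "Z i \<in> borel_measurable (PiM (K i) (\<lambda>_. perm_measure))"
    proof (cases "i = 0")
      case True
      thus ?thesis by (simp add: Z_def)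
    next
      case False
      thus ?thesis by (simp add: Z_def measurable_scr_tail' K_def)
    qed
    show "Z i (restrict \<omega> (K i)) = Z i \<omega>" for \<omega>
    proof (cases "i = 0")
      case True
      thus ?thesis using cell_restrict by (simp add: Z_def)
    next
      case False
      thus ?thesis by (simp add: Z_def scr_tail_def scr_digit_Suc K_def)
    qed
  qed
  define B where "B i = (if i = 0 then {1} else A i)" for i
  have E: "E = Z 0 -` B 0 \<inter> space scr_measure"
    by (auto simp: E_def Z_def B_def split: if_splits)
  have "{\<omega> \<in> E. \<forall>i\<in>{1..b ^ m}. scr_tail b m i \<omega> \<in> A i} = (\<Inter>i\<in>{0..b ^ m}. Z i -` B i \<inter> space scr_measure)"
    unfolding E by (auto simp: Z_def B_def split: if_splits)
  also have "prob \<dots> = (\<Prod>i\<in>{0..b ^ m}. prob (Z i -` B i \<inter> space scr_measure))"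
    by (rule indep_varsD[OF ind]) (auto simp: B_def A)
  also have "\<dots> = prob E * (\<Prod>i = 1..b ^ m. prob (Z i -` B i \<inter> space scr_measure))"
    unfolding E by (subst prod.atLeast_Suc_atMost) auto
  also have "(\<Prod>i = 1..b ^ m. prob (Z i -` B i \<inter> space scr_measure))
    = (\<Prod>i = 1..b ^ m. measure (uniform_measure lborel {0..1}) (A i))"
  proof (rule prod.cong[OF refl])
    fix i assume i: "i \<in> {1..b ^ m}"
    have "measure (uniform_measure lborel {0..1}) (A i) = measure (distr scr_measure borel (scr_tail b m i)) (A i)"
      by (simp only: distr_scr_tail)
    also have "\<dots> = prob (scr_tail b m i -` A i \<inter> space scr_measure)"
      using A[OF i] by (intro measure_distr) auto
    finally show "prob (Z i -` B i \<inter> space scr_measure) = measure (uniform_measure lborel {0..1}) (A i)"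
      using i by (simp add: Z_def B_def)
  qed
  finally show ?thesis .
qed

text \<open>Conditionally on the assignment of points to cells, the positions are the tails in permuted
  order; as the tails are i.i.d. and independent of the assignment, the conditioning is immaterial.\<close>
lemma prob_cell_pos:
  assumes A: "\<And>k. k < b ^ m \<Longrightarrow> A k \<in> sets borel"
  shows "measure scr_measure {\<omega> \<in> space scr_measure. \<forall>k<b ^ m. cell_pos b m k \<omega> \<in> A k}
    = (\<Prod>k<b ^ m. measure (uniform_measure lborel {0..1}) (A k))"
proof -
  interpret prob_space scr_measure by (rule prob_space_scr_measure)
  let ?\<nu> = "measure (uniform_measure lborel {0..1::real})"
  \<comment> \<open>Extensional functions are taken so that different elements of \<open>S\<close>
    differ at some index in range; this makes the events \<open>E s\<close> disjoint.\<close>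
  define S where "S = {s \<in> {1..b ^ m} \<rightarrow>\<^sub>E {..<b ^ m}. bij_betw s {1..b ^ m} {..<b ^ m}}"
  define E where "E s = {\<omega> \<in> space scr_measure. \<forall>i\<in>{1..b ^ m}. scr_cell b m i \<omega> = s i}" for s
  define V where "V = {\<omega> \<in> space scr_measure. \<forall>k<b ^ m. cell_pos b m k \<omega> \<in> A k}"
  have finS: "finite S" unfolding S_def by (rule finite_subset[of _ "{1..b ^ m} \<rightarrow>\<^sub>E {..<b ^ m}"]) (auto intro: finite_PiE)
  have E_sets: "E s \<in> events" for s unfolding E_def by measurable
  have V_sets: "V \<in> events" unfolding V_def using A by measurable
  have cover: "\<exists>s\<in>S. \<omega> \<in> E s" if w: "\<omega> \<in> space scr_measure" for \<omega>
  proof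
    show "\<omega> \<in> E (restrict (\<lambda>i. scr_cell b m i \<omega>) {1..b ^ m})" using w by (simp add: E_def)
    show "restrict (\<lambda>i. scr_cell b m i \<omega>) {1..b ^ m} \<in> S"
      using bij_betw_scr_cell[OF w, of m] bij_betwE[OF bij_betw_scr_cell[OF w, of m]]
        bij_betw_cong[of "{1..b ^ m}" "restrict (\<lambda>i. scr_cell b m i \<omega>) {1..b ^ m}" "\<lambda>i. scr_cell b m i \<omega>"]
      unfolding S_def by auto
  qed
  have disj: "disjoint_family_on E S"
    unfolding disjoint_family_on_def
  proof (intro ballI impI)
    fix s s' assume *: "s \<in> S" "s' \<in> S" "s \<noteq> s'"
    have "s = s'" if "\<omega> \<in> E s" "\<omega> \<in> E s'" for \<omega>
      by (rule PiE_ext[of _ "{1..b ^ m}" "\<lambda>_. {..<b ^ m}"]) (use * that in \<open>auto simp: S_def E_def\<close>)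
    with * show "E s \<inter> E s' = {}" by blast
  qed
  have tot: "(\<Sum>s\<in>S. prob (E s)) = 1"
  proof -
    have "(\<Sum>s\<in>S. prob (E s)) = prob (\<Union>s\<in>S. E s)"
      by (rule finite_measure_finite_Union[symmetric, OF finS]) (use E_sets disj in auto)
    also have "(\<Union>s\<in>S. E s) = space scr_measure" using cover by (auto simp: E_def)
    finally show ?thesis by (simp add: prob_space)
  qed
  \<comment> \<open>On \<open>E s\<close> the position in cell \<open>s i\<close> is the tail of
    point \<open>i\<close>. Reindexing along the bijection \<open>s\<close> removes \<open>s\<close>
    from the product, so it factors out of the sum over \<open>S\<close>, whose weights add up to
    1.\<close>
  have one: "prob (V \<inter> E s) = prob (E s) * (\<Prod>k<b ^ m. ?\<nu> (A k))" if s: "s \<in> S" for s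
  proof -
    have bij: "bij_betw s {1..b ^ m} {..<b ^ m}" using s by (simp add: S_def)
    have "V \<inter> E s = {\<omega> \<in> E s. \<forall>i\<in>{1..b ^ m}. scr_tail b m i \<omega> \<in> A (s i)}"
    proof -
      have "(\<forall>k<b ^ m. cell_pos b m k \<omega> \<in> A k) \<longleftrightarrow> (\<forall>i\<in>{1..b ^ m}. scr_tail b m i \<omega> \<in> A (s i))"
        if w: "\<omega> \<in> E s" for \<omega>
      proof -
        have "(\<forall>k<b ^ m. cell_pos b m k \<omega> \<in> A k) \<longleftrightarrow> (\<forall>k\<in>s ` {1..b ^ m}. cell_pos b m k \<omega> \<in> A k)"
          unfolding bij_betw_imp_surj_on[OF bij] by auto
        also have "\<dots> \<longleftrightarrow> (\<forall>i\<in>{1..b ^ m}. cell_pos b m (s i) \<omega> \<in> A (s i))" by blast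
        also have "\<dots> \<longleftrightarrow> (\<forall>i\<in>{1..b ^ m}. scr_tail b m i \<omega> \<in> A (s i))"
          using cell_pos_scr_cell[of \<omega> _ m] w by (intro ball_cong) (auto simp: E_def)
        finally show ?thesis .
      qed
      thus ?thesis by (auto simp: V_def E_def)
    qed
    moreover have "prob {\<omega> \<in> E s. \<forall>i\<in>{1..b ^ m}. scr_tail b m i \<omega> \<in> A (s i)}
      = prob (E s) * (\<Prod>i = 1..b ^ m. ?\<nu> (A (s i)))"
      unfolding E_def
      by (rule indep_scr_cell_tail[where s = s and A = "\<lambda>i. A (s i)"]) (use A bij_betwE[OF bij] in auto)
    moreover have "(\<Prod>i = 1..b ^ m. ?\<nu> (A (s i))) = (\<Prod>k<b ^ m. ?\<nu> (A k))"
      by (rule prod.reindex_bij_betw[OF bij, of "\<lambda>k. ?\<nu> (A k)"])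
    ultimately show ?thesis by (simp only:)
  qed
  have "V = (\<Union>s\<in>S. V \<inter> E s)" using cover V_def by blast
  hence "prob V = prob (\<Union>s\<in>S. V \<inter> E s)" by simp
  also have "\<dots> = (\<Sum>s\<in>S. prob (V \<inter> E s))"
    by (rule finite_measure_finite_Union[OF finS]) (use E_sets V_sets disj in \<open>auto simp: disjoint_family_on_def\<close>)
  also have "\<dots> = (\<Sum>s\<in>S. prob (E s) * (\<Prod>k<b ^ m. ?\<nu> (A k)))" by (rule sum.cong[OF refl one])
  also have "\<dots> = (\<Prod>k<b ^ m. ?\<nu> (A k))" using tot by (simp flip: sum_distrib_right)
  finally show ?thesis by (simp add: V_def)
qed

text \<open>The marginal comes from the joint law by taking \<open>UNIV\<close> for all cells but
  one.\<close>

lemma distr_cell_pos: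
  assumes k: "k < b ^ m"
  shows "distr scr_measure borel (cell_pos b m k) = uniform_measure lborel {0..1}"
proof (rule measure_eqI)
  interpret prob_space scr_measure by (rule prob_space_scr_measure)
  interpret L: prob_space "uniform_measure lborel {0..1::real}"
    by (rule prob_space_uniform_measure) auto
  fix A assume "A \<in> sets (distr scr_measure borel (cell_pos b m k))"
  hence A: "A \<in> sets borel" by simp
  have sp: "space scr_measure \<noteq> {}" by (rule not_empty)
  have "emeasure (distr scr_measure borel (cell_pos b m k)) A
    = emeasure scr_measure (cell_pos b m k -` A \<inter> space scr_measure)"
    using A by (intro emeasure_distr) auto
  also have "cell_pos b m k -` A \<inter> space scr_measure
    = {\<omega> \<in> space scr_measure. \<forall>j<b ^ m. cell_pos b m j \<omega> \<in> (if j = k then A else UNIV)}"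
    using k by auto
  also have "emeasure scr_measure \<dots> = ennreal (\<Prod>j<b ^ m. L.prob (if j = k then A else UNIV))"
    unfolding emeasure_eq_measure by (subst prob_cell_pos) (use A in auto)
  also have "(\<Prod>j<b ^ m. L.prob (if j = k then A else UNIV)) = (\<Prod>j<b ^ m. if j = k then L.prob A else 1)"
    using L.prob_space by (intro prod.cong) auto
  also have "\<dots> = L.prob A" using k by simp
  finally show "emeasure (distr scr_measure borel (cell_pos b m k)) A = emeasure (uniform_measure lborel {0..1}) A"
    by (simp add: L.emeasure_eq_measure)
qed simp

lemma indep_cell_pos: "prob_space.indep_vars scr_measure (\<lambda>_. borel) (cell_pos b m) {..<b ^ m}"
proof -
  interpret prob_space scr_measure by (rule prob_space_scr_measure)
  have p: "measure (uniform_measure lborel {0..1}) A = prob (cell_pos b m k -` A \<inter> space scr_measure)"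
    if "k < b ^ m" "A \<in> sets borel" for k A
    unfolding distr_cell_pos[OF that(1), symmetric] using that(2) by (intro measure_distr) auto
  have ne: "{..<b ^ m} \<noteq> {}" using b by (auto simp: lessThan_empty_iff)
  show ?thesis
  proof (subst indep_vars_finite[where E = "\<lambda>_. sets borel"])
    show "\<forall>A\<in>{..<b ^ m} \<rightarrow> sets borel. prob (\<Inter>j\<in>{..<b ^ m}. cell_pos b m j -` A j \<inter> space scr_measure)
      = (\<Prod>j\<in>{..<b ^ m}. prob (cell_pos b m j -` A j \<inter> space scr_measure))"
    proof
      fix A :: "nat \<Rightarrow> real set" assume A: "A \<in> {..<b ^ m} \<rightarrow> sets borel"
      have "(\<Inter>j\<in>{..<b ^ m}. cell_pos b m j -` A j \<inter> space scr_measure)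
        = {\<omega> \<in> space scr_measure. \<forall>k<b ^ m. cell_pos b m k \<omega> \<in> A k}" using ne by auto
      also have "prob \<dots> = (\<Prod>k<b ^ m. measure (uniform_measure lborel {0..1}) (A k))"
        by (rule prob_cell_pos) (use A in auto)
      also have "\<dots> = (\<Prod>j\<in>{..<b ^ m}. prob (cell_pos b m j -` A j \<inter> space scr_measure))"
        by (rule prod.cong[OF refl p]) (use A in auto)
      finally show "prob (\<Inter>j\<in>{..<b ^ m}. cell_pos b m j -` A j \<inter> space scr_measure)
        = (\<Prod>j\<in>{..<b ^ m}. prob (cell_pos b m j -` A j \<inter> space scr_measure))" .
    qed
  qed (use ne in \<open>auto simp: sets.sigma_sets_eq[of borel, simplified] Int_stable_def\<close>)
qed

end

section \<open>Measure-preserving curves\<close>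

text \<open>A preimage under \<open>f\<close> differs from the one under \<open>g\<close> only
  inside a null set, and the completion contains all subsets of null sets. This is how
  \<open>mu_hat\<close> becomes measurable.\<close>

lemma measurable_completion_AE_eq:
  assumes g: "g \<in> borel_measurable M" and ae: "AE x in M. f x = g x"
  shows "f \<in> borel_measurable (completion M)"
proof (rule measurableI)
  fix A :: "'b set" assume A: "A \<in> sets borel"
  obtain N where N: "{x \<in> space M. f x \<noteq> g x} \<subseteq> N" "N \<in> null_sets M"
    using ae by (auto simp: eventually_ae_filter)
  have "f -` A \<inter> space M = ((g -` A \<inter> space M) - N) \<union> (f -` A \<inter> space M \<inter> N)"
    using N(1) by auto
  moreover have "(g -` A \<inter> space M) - N \<in> sets M"
    using measurable_sets[OF g A] N(2) by auto
  moreover have "f -` A \<inter> space M \<inter> N \<in> sets (completion M)"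
    by (rule null_sets_completion[OF N(2)]) auto
  ultimately show "f -` A \<inter> space (completion M) \<in> sets (completion M)"
    by (metis sets.Un sets_completionI_sets space_completion)
qed simp

lemma (in prob_space) variance_indicator:
  assumes A: "A \<in> events"
  shows "expectation (\<lambda>\<omega>. (indicator A \<omega> - prob A)\<^sup>2) = prob A * (1 - prob A)"
proof -
  have "(indicator A \<omega> - prob A)\<^sup>2 = (1 - 2 * prob A) * indicator A \<omega> + (prob A)\<^sup>2" for \<omega>
    by (simp add: indicator_def power2_eq_square algebra_simps)
  moreover have "integrable M (\<lambda>\<omega>. (1 - 2 * prob A) * indicator A \<omega>)"
    using A by (intro integrable_mult_right integrable_real_indicator) (auto simp: less_top[symmetric])
  ultimately have "expectation (\<lambda>\<omega>. (indicator A \<omega> - prob A)\<^sup>2) = (1 - 2 * prob A) * prob A + (prob A)\<^sup>2"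
    using A by (simp add: prob_space)
  thus ?thesis by (simp add: power2_eq_square algebra_simps)
qed

lemma uniform_rescale:
  fixes k n :: nat
  assumes n: "n > 0" and A: "A \<in> sets borel"
  shows "measure (uniform_measure lborel {0..1}) {v. (real k + v) / real n \<in> A}
    = real n * measure lborel (A \<inter> {real k / real n..real (Suc k) / real n})"
proof -
  let ?g = "\<lambda>v. real k / real n + 1 / real n * v"
  let ?I = "{real k / real n..real (Suc k) / real n}"
  have meas: "{v. (real k + v) / real n \<in> A} \<in> sets borel"
    using measurable_sets_borel[of "\<lambda>v. (real k + v) / real n" borel A] A by (simp add: vimage_def)
  have vim: "?g -` (A \<inter> ?I) = {0..1} \<inter> {v. (real k + v) / real n \<in> A}"
    using n by (auto simp: field_simps)
  have "emeasure lborel (A \<inter> ?I) = ennreal (1 / real n) * emeasure lborel (?g -` (A \<inter> ?I))"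
    using A n by (subst lborel_real_affine[of "1 / real n" "real k / real n"])
      (simp_all add: emeasure_density_const emeasure_distr)
  hence "measure lborel (A \<inter> ?I) = 1 / real n * measure lborel ({0..1} \<inter> {v. (real k + v) / real n \<in> A})"
    unfolding vim measure_def by (simp add: enn2real_mult)
  thus ?thesis using n meas by simp
qed

lemma fmeasurable_Int_Icc:
  fixes B :: "real set"
  assumes "B \<in> sets borel"
  shows "B \<inter> {x..y} \<in> fmeasurable lborel"
proof -
  have "{x..y} \<in> fmeasurable lborel" by (cases "x \<le> y") (auto intro!: fmeasurableI)
  from fmeasurable_Int_fmeasurable[OF this, of B] assms show ?thesis by (simp add: Int_commute)
qed

text \<open>Neighbouring closed cells overlap in their common endpoint, a null set, so measure is
  still additive over them.\<close>

lemma measure_Int_grid: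
  fixes B :: "real set" and n :: nat
  assumes n: "n > 0" and B: "B \<in> sets borel"
  shows "measure lborel (B \<inter> {0..real j / real n})
    = (\<Sum>k<j. measure lborel (B \<inter> {real k / real n..real (Suc k) / real n}))"
proof (induction j)
  case 0
  show ?case by (cases "0 \<in> B") (auto simp: measure_def)
next
  case (Suc j)
  note fm = fmeasurable_Int_Icc[OF B]
  have "B \<inter> {0..real (Suc j) / real n} = (B \<inter> {0..real j / real n}) \<union> (B \<inter> {real j / real n..real (Suc j) / real n})"
    using ivl_disj_un_two_touch(4)[of 0 "real j / real n" "real (Suc j) / real n"]
    by (simp add: divide_right_mono flip: Int_Un_distrib)
  also have "measure lborel \<dots> = measure lborel (B \<inter> {0..real j / real n})
     + measure lborel (B \<inter> {real j / real n..real (Suc j) / real n})"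
  proof (rule measure_Un_AE[OF _ fm fm])
    show "AE x in lborel. x \<notin> B \<inter> {0..real j / real n} \<or> x \<notin> B \<inter> {real j / real n..real (Suc j) / real n}"
      using AE_lborel_singleton[of "real j / real n"] by eventually_elim auto
  qed
  finally show ?case using Suc by simp
qed

text \<open>The curve is captured by continuity, surjectivity and measure preservation instead of
  its recursive construction. As \<open>H\<close> is total on the reals, Borel measurability is a
  condition outside the unit interval too.\<close>

locale hilbert_like =
  fixes H :: "real \<Rightarrow> 'a :: euclidean_space" and \<Omega> :: "'a set"
  assumes H_cont: "continuous_on {0..1} H"
    and H_meas: "H \<in> borel_measurable borel"
    and H_onto: "H ` {0..1} = cbox 0 One"
    and H_vol: "\<And>p q. 0 \<le> p \<Longrightarrow> p \<le> q \<Longrightarrow> q \<le> 1 \<Longrightarrow> measure lebesgue (H ` {p..q}) = q - p"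
    and H_unif: "\<And>p q. 0 \<le> p \<Longrightarrow> p < q \<Longrightarrow> q \<le> 1 \<Longrightarrow>
                   distr (uniform_measure lborel {p..q}) borel H = uniform_measure lborel (H ` {p..q})"
    and \<Omega>_meas: "\<Omega> \<in> sets lebesgue"
    and \<Omega>_sub: "\<Omega> \<subseteq> cbox 0 One"
begin

lemma image_borel: "0 \<le> p \<Longrightarrow> q \<le> 1 \<Longrightarrow> H ` {p..q} \<in> sets borel"
  by (rule borel_compact[OF compact_continuous_image[OF continuous_on_subset[OF H_cont]]]) auto

lemma emeasure_image:
  assumes "0 \<le> p" "p \<le> q" "q \<le> 1"
  shows "emeasure lborel (H ` {p..q}) = ennreal (q - p)"
proof -
  have "bounded (H ` {p..q})"
    using assms by (intro compact_imp_bounded compact_continuous_image continuous_on_subset[OF H_cont]) auto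
  hence "emeasure lborel (H ` {p..q}) < \<infinity>" by (rule emeasure_bounded_finite)
  moreover have "measure lborel (H ` {p..q}) = q - p"
    using H_vol[OF assms] image_borel[of p q] assms by simp
  ultimately show ?thesis by (simp add: emeasure_eq_ennreal_measure less_top[symmetric])
qed

text \<open>Both uniform measures in \<open>H_unif\<close> are normalised by the same number
  \<open>q - p\<close>, which cancels when they are evaluated at \<open>S\<close>.\<close>

lemma measure_vimage_Int:
  assumes pq: "0 \<le> p" "p < q" "q \<le> 1" and S: "S \<in> sets borel"
  shows "measure lborel (H -` S \<inter> {p..q}) = measure lborel (S \<inter> H ` {p..q})"
proof -
  have HS: "H -` S \<in> sets borel" using measurable_sets_borel[OF H_meas S] .
  have "measure lborel ({p..q} \<inter> H -` S) / (q - p) = measure (uniform_measure lborel {p..q}) (H -` S)"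
    using HS pq by simp
  also have "\<dots> = measure (distr (uniform_measure lborel {p..q}) borel H) S"
    using S H_meas by (subst measure_distr) auto
  also have "\<dots> = measure (uniform_measure lborel (H ` {p..q})) S" by (simp only: H_unif[OF pq])
  also have "\<dots> = measure lborel (H ` {p..q} \<inter> S) / (q - p)"
    using emeasure_image[of p q] H_vol[of p q] image_borel[of p q] pq S by simp
  finally show ?thesis using pq by (simp add: Int_commute)
qed

text \<open>\<open>\<Omega>\<close> is only Lebesgue measurable, so its preimage need not be Borel; off a null set it agrees
  with the preimage of the Borel part of \<open>\<Omega>\<close>.\<close>
lemma pullback:
  obtains B Z :: "real set" where
    "B \<in> sets borel" "Z \<in> sets borel" "\<And>x. x \<notin> Z \<Longrightarrow> H x \<in> \<Omega> \<longleftrightarrow> x \<in> B"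
    "measure lborel (Z \<inter> {0..1}) = 0"
    "\<And>p q. 0 \<le> p \<Longrightarrow> p < q \<Longrightarrow> q \<le> 1 \<Longrightarrow> measure lborel (B \<inter> {p..q}) = measure lebesgue (\<Omega> \<inter> H ` {p..q})"
proof -
  define S where "S = main_part lborel \<Omega>"
  obtain N where N: "N \<in> null_sets lborel" "null_part lborel \<Omega> \<subseteq> N"
    using null_part[OF \<Omega>_meas] by blast
  have S: "S \<in> sets borel" using main_part_sets[OF \<Omega>_meas] by (simp add: S_def)
  have \<Omega>: "\<Omega> = S \<union> null_part lborel \<Omega>" using main_part_null_part_Un[OF \<Omega>_meas] by (simp add: S_def)
  show ?thesis
  proof (rule that[of "H -` S" "H -` N"])
    show "H -` S \<in> sets borel" using measurable_sets_borel[OF H_meas S] .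
    show "H -` N \<in> sets borel" using measurable_sets_borel[OF H_meas, of N] N by auto
    show "H x \<in> \<Omega> \<longleftrightarrow> x \<in> H -` S" if "x \<notin> H -` N" for x
      using that N(2) \<Omega> by auto
    \<comment> \<open>Measure preservation pulls the null set \<open>N\<close> back to a null set,
      but only within \<open>[0,1]\<close>, where the curve is controlled.\<close>
    have "measure lborel (H -` N \<inter> {0..1}) = measure lborel (N \<inter> H ` {0..1})"
      using N by (intro measure_vimage_Int) auto
    also have "\<dots> = 0"
      using N(1) image_borel[of 0 1] by (simp add: measure_eq_0_null_sets null_set_Int2)
    finally show "measure lborel (H -` N \<inter> {0..1}) = 0" .
    fix p q :: real assume pq: "0 \<le> p" "p < q" "q \<le> 1"
    have E: "H ` {p..q} \<in> sets borel" using pq by (intro image_borel) auto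
    have "measure lborel (H -` S \<inter> {p..q}) = measure lebesgue (S \<inter> H ` {p..q})"
      using measure_vimage_Int[OF pq S] S E by simp
    also have "\<dots> = measure lebesgue (\<Omega> \<inter> H ` {p..q})"
    proof (rule measure_eq_AE)
      have "AE x in lebesgue. x \<notin> N" using N(1) by (intro AE_completion AE_not_in)
      thus "AE x in lebesgue. x \<in> S \<inter> H ` {p..q} \<longleftrightarrow> x \<in> \<Omega> \<inter> H ` {p..q}"
        by eventually_elim (use N(2) \<Omega> in auto)
    qed (use S E \<Omega>_meas in auto)
    finally show "measure lborel (H -` S \<inter> {p..q}) = measure lebesgue (\<Omega> \<inter> H ` {p..q})" .
  qed
qed

text \<open>A cell has volume \<open>1 / n\<close>, so \<open>p\<close> is the conditional
  probability of \<open>\<Omega>\<close> given the cell. The same Bernoulli form arises for the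
  summands of the estimate, which links them to the hypothesis on boundary cells.\<close>

lemma cell_var_eq:
  assumes i: "i \<in> {1..n}"
  defines "p \<equiv> real n * measure lebesgue (\<Omega> \<inter> cell H n i)"
  shows "cell_var H \<Omega> n i = p * (1 - p)"
proof -
  have n: "n > 0" using i by auto
  have b: "0 \<le> (real i - 1) / real n" "(real i - 1) / real n \<le> real i / real n" "real i / real n \<le> 1"
    using i by (auto simp: divide_simps)
  have E: "cell H n i \<in> sets borel" unfolding cell_def using b by (intro image_borel) auto
  have em: "emeasure lebesgue (cell H n i) = ennreal (1 / real n)"
    using emeasure_image[OF b] E n unfolding cell_def by (simp add: diff_divide_distrib)
  have me: "measure lebesgue (cell H n i) = 1 / real n" using em by (simp add: measure_def)
  interpret U: prob_space "uniform_measure lebesgue (cell H n i)"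
    by (rule prob_space_uniform_measure) (use em n in auto)
  have p: "U.prob \<Omega> = p"
    using em me n \<Omega>_meas by (subst measure_uniform_measure) (auto simp: p_def Int_commute)
  have "U.expectation (indicator \<Omega>) = U.prob \<Omega>" using \<Omega>_meas by simp
  thus ?thesis
    using U.variance_indicator[of \<Omega>] \<Omega>_meas unfolding cell_var_def Let_def p by simp
qed

end

section \<open>The scrambled estimate\<close>

locale scrambled_hilbert = hilbert_like H \<Omega>
  for H :: "real \<Rightarrow> 'a :: euclidean_space" and \<Omega> :: "'a set" +
  fixes b :: nat
  assumes b: "b \<ge> 2"
begin

abbreviation scr_prob where
  "scr_prob \<equiv> PiM (UNIV :: nat list set) (\<lambda>_. uniform_count_measure {p. p permutes {0..<b}})"

lemma scr_space_eq: "scr_space b = completion scr_prob"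
  by (simp add: scr_space_def)

lemma prob_space_scr_prob: "prob_space scr_prob"
  by (rule prob_space_scr_measure[OF b])

definition point where "point m k \<omega> = (real k + cell_pos b m k \<omega>) / real (b ^ m)"

text \<open>\<open>Suc k\<close> translates the count from 0 used by \<open>point\<close> into the
  count from 1 used by \<open>cell\<close>.\<close>

definition cell_prob where "cell_prob m k = real (b ^ m) * measure lebesgue (\<Omega> \<inter> cell H (b ^ m) (Suc k))"

lemma measurable_point [measurable]: "point m k \<in> borel_measurable scr_prob"
  using measurable_cell_pos[OF b, of m k] unfolding point_def[abs_def] by measurable

lemma prob_point:
  assumes k: "k < b ^ m" and A: "A \<in> sets borel"
  shows "measure scr_prob {\<omega> \<in> space scr_prob. point m k \<omega> \<in> A}
    = real (b ^ m) * measure lborel (A \<inter> {real k / real (b ^ m)..real (Suc k) / real (b ^ m)})"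
proof -
  have A': "{v. (real k + v) / real (b ^ m) \<in> A} \<in> sets borel"
    using measurable_sets_borel[of "\<lambda>v. (real k + v) / real (b ^ m)" borel A] A by (simp add: vimage_def)
  have "measure scr_prob {\<omega> \<in> space scr_prob. point m k \<omega> \<in> A}
    = measure (distr scr_prob borel (cell_pos b m k)) {v. (real k + v) / real (b ^ m) \<in> A}"
    by (subst measure_distr[OF measurable_cell_pos[OF b] A']) (auto simp: point_def intro!: arg_cong[where f = "measure _"])
  also have "\<dots> = measure (uniform_measure lborel {0..1}) {v. (real k + v) / real (b ^ m) \<in> A}"
    by (simp only: distr_cell_pos[OF b k])
  also have "\<dots> = real (b ^ m) * measure lborel (A \<inter> {real k / real (b ^ m)..real (Suc k) / real (b ^ m)})"
    by (rule uniform_rescale[OF _ A]) (use b in simp)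
  finally show ?thesis .
qed

text \<open>Each point is uniform on its interval, so almost surely none falls into the exceptional
  null set, and \<open>\<Omega>\<close> may be replaced by a Borel set \<open>B\<close> of
  parameters. The identity for the sum of the \<open>cell_prob\<close> is unbiasedness of the
  estimate.\<close>

lemma estimator_representation:
  obtains B where "B \<in> sets borel"
    "\<And>m k. k < b ^ m \<Longrightarrow> measure scr_prob {\<omega> \<in> space scr_prob. point m k \<omega> \<in> B} = cell_prob m k"
    "\<And>m. (\<Sum>k<b ^ m. cell_prob m k) = real (b ^ m) * measure lebesgue \<Omega>"
    "\<And>m. AE \<omega> in scr_prob. mu_hat b H \<Omega> (b ^ m) \<omega> = (\<Sum>k<b ^ m. indicator B (point m k \<omega>)) / real (b ^ m)"
proof -
  interpret prob_space scr_prob by (rule prob_space_scr_prob)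
  obtain B Z :: "real set" where B: "B \<in> sets borel" and Z: "Z \<in> sets borel"
    and BZ: "\<And>x. x \<notin> Z \<Longrightarrow> H x \<in> \<Omega> \<longleftrightarrow> x \<in> B" and Z0: "measure lborel (Z \<inter> {0..1}) = 0"
    and Bm: "\<And>p q. 0 \<le> p \<Longrightarrow> p < q \<Longrightarrow> q \<le> 1 \<Longrightarrow> measure lborel (B \<inter> {p..q}) = measure lebesgue (\<Omega> \<inter> H ` {p..q})"
    by (rule pullback) blast
  have bm: "b ^ m > 0" for m using b by simp
  have cell: "measure lborel (B \<inter> {real k / real (b ^ m)..real (Suc k) / real (b ^ m)})
    = measure lebesgue (\<Omega> \<inter> cell H (b ^ m) (Suc k))" if "k < b ^ m" for m k
  proof -
    have "real (Suc k) \<le> real (b ^ m)" using that by (intro of_nat_mono) simp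
    thus ?thesis using bm[of m] unfolding cell_def
      by (subst Bm) (auto simp: divide_simps simp del: of_nat_power)
  qed
  show ?thesis
  proof (rule that[OF B])
    show "prob {\<omega> \<in> space scr_prob. point m k \<omega> \<in> B} = cell_prob m k" if "k < b ^ m" for m k
      unfolding cell_prob_def prob_point[OF that B] cell[OF that] ..
    show "(\<Sum>k<b ^ m. cell_prob m k) = real (b ^ m) * measure lebesgue \<Omega>" for m
    proof -
      have "(\<Sum>k<b ^ m. cell_prob m k)
        = real (b ^ m) * (\<Sum>k<b ^ m. measure lborel (B \<inter> {real k / real (b ^ m)..real (Suc k) / real (b ^ m)}))"
        unfolding cell_prob_def sum_distrib_left by (intro sum.cong refl, subst cell) auto
      also have "\<dots> = real (b ^ m) * measure lborel (B \<inter> {0..real (b ^ m) / real (b ^ m)})"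
        by (simp only: measure_Int_grid[OF bm B])
      also have "real (b ^ m) / real (b ^ m) = 1" using bm[of m] by simp
      also have "measure lborel (B \<inter> {0..1}) = measure lebesgue (\<Omega> \<inter> H ` {0..1})" by (rule Bm) auto
      also have "\<Omega> \<inter> H ` {0..1} = \<Omega>" using H_onto \<Omega>_sub by auto
      finally show ?thesis .
    qed
    show "AE \<omega> in scr_prob. mu_hat b H \<Omega> (b ^ m) \<omega> = (\<Sum>k<b ^ m. indicator B (point m k \<omega>)) / real (b ^ m)" for m
    proof -
      have "AE \<omega> in scr_prob. point m k \<omega> \<notin> Z" if k: "k < b ^ m" for k
      proof -
        have "real (Suc k) \<le> real (b ^ m)" using k by (intro of_nat_mono) simp
        hence "measure lborel (Z \<inter> {real k / real (b ^ m)..real (Suc k) / real (b ^ m)}) \<le> measure lborel (Z \<inter> {0..1})"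
          using bm[of m] Z
          by (intro measure_mono_fmeasurable fmeasurable_Int_Icc[OF Z] sets.Int Int_mono order.refl)
            (auto simp: divide_simps simp del: of_nat_power)
        hence "prob {\<omega> \<in> space scr_prob. point m k \<omega> \<in> Z} = 0"
          unfolding prob_point[OF k Z] Z0 by (simp add: measure_le_0_iff)
        thus ?thesis using Z by (subst (asm) prob_eq_0) auto
      qed
      hence "AE \<omega> in scr_prob. \<forall>k\<in>{..<b ^ m}. point m k \<omega> \<notin> Z"
        by (intro AE_finite_allI) auto
      thus ?thesis using AE_space
      proof eventually_elim
        case (elim \<omega>)
        have "(\<Sum>i = 1..b ^ m. indicator \<Omega> (H (scr_point b \<omega> i))) = (\<Sum>k<b ^ m. indicator \<Omega> (H (point m k \<omega>)) :: real)"
          unfolding point_def by (rule sum_scr_point[OF b elim(2)])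
        also have "\<dots> = (\<Sum>k<b ^ m. indicator B (point m k \<omega>))"
          using elim(1) BZ by (intro sum.cong) (auto simp: indicator_def)
        finally show ?case by (simp add: mu_hat_def)
      qed
    qed
  qed
qed

text \<open>Almost surely the centred estimate is the sum of the \<open>X m k\<close> divided by
  \<open>b ^ m\<close>, and its standard deviation carries the same divisor, which cancels. Passing
  to the completion changes neither integrals nor laws of product-measurable functions.\<close>

lemma estimator_standardized:
  obtains X :: "nat \<Rightarrow> nat \<Rightarrow> (nat list \<Rightarrow> nat \<Rightarrow> nat) \<Rightarrow> real" where
    "\<And>m. prob_space.indep_vars scr_prob (\<lambda>_. borel) (X m) {..<b ^ m}"
    "\<And>m k \<omega>. \<bar>X m k \<omega>\<bar> \<le> 1"
    "\<And>m k. k < b ^ m \<Longrightarrow> integral\<^sup>L scr_prob (X m k) = 0"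
    "\<And>m k. k < b ^ m \<Longrightarrow> integral\<^sup>L scr_prob (\<lambda>\<omega>. (X m k \<omega>)\<^sup>2) = cell_var H \<Omega> (b ^ m) (Suc k)"
    "\<And>m. distr (scr_space b) borel (\<lambda>\<omega>. (mu_hat b H \<Omega> (b ^ m) \<omega> - measure lebesgue \<Omega>) / sqrt (est_var b H \<Omega> (b ^ m)))
      = distr scr_prob borel (\<lambda>\<omega>. (\<Sum>k<b ^ m. X m k \<omega>) / sqrt (\<Sum>k<b ^ m. integral\<^sup>L scr_prob (\<lambda>\<omega>. (X m k \<omega>)\<^sup>2)))"
proof -
  interpret prob_space scr_prob by (rule prob_space_scr_prob)
  obtain B where B[measurable]: "B \<in> sets borel"
    and pB: "\<And>m k. k < b ^ m \<Longrightarrow> prob {\<omega> \<in> space scr_prob. point m k \<omega> \<in> B} = cell_prob m k"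
    and sum_p: "\<And>m. (\<Sum>k<b ^ m. cell_prob m k) = real (b ^ m) * measure lebesgue \<Omega>"
    and ae: "\<And>m. AE \<omega> in scr_prob. mu_hat b H \<Omega> (b ^ m) \<omega> = (\<Sum>k<b ^ m. indicator B (point m k \<omega>)) / real (b ^ m)"
    by (rule estimator_representation) blast
  define E where "E m k = {\<omega> \<in> space scr_prob. point m k \<omega> \<in> B}" for m k
  have E: "E m k \<in> events" for m k unfolding E_def by measurable
  \<comment> \<open>In this form \<open>X m k\<close> is a Borel function of
    \<open>cell_pos b m k\<close> and inherits independence; \<open>XE\<close> rewrites it as a
    centred indicator for the mean and the variance.\<close>
  define X where "X m k \<omega> = indicator B (point m k \<omega>) - prob (E m k)" for m k \<omega>
  have XE: "X m k \<omega> = indicator (E m k) \<omega> - prob (E m k)" if "\<omega> \<in> space scr_prob" for m k \<omega>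
    using that by (simp add: X_def E_def indicator_def)
  have X[measurable]: "X m k \<in> borel_measurable scr_prob" for m k unfolding X_def[abs_def] by measurable
  have ind: "indep_vars (\<lambda>_. borel) (X m) {..<b ^ m}" for m
    unfolding X_def[abs_def] point_def
    by (rule indep_vars_compose2[OF indep_cell_pos[OF b]]) measurable
  have bd: "\<bar>X m k \<omega>\<bar> \<le> 1" for m k \<omega>
    using prob_le_1[of "E m k"] measure_nonneg[of scr_prob "E m k"] by (auto simp: X_def indicator_def)
  have mean: "expectation (X m k) = 0" for m k
  proof -
    have "expectation (X m k) = expectation (\<lambda>\<omega>. indicator (E m k) \<omega> - prob (E m k))"
      by (rule Bochner_Integration.integral_cong) (simp_all add: XE)
    also have "\<dots> = expectation (indicator (E m k)) - prob (E m k)"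
      using E[of m k] by (subst Bochner_Integration.integral_diff) (auto simp: prob_space less_top[symmetric])
    finally show ?thesis using E[of m k] by simp
  qed
  have var: "expectation (\<lambda>\<omega>. (X m k \<omega>)\<^sup>2) = cell_var H \<Omega> (b ^ m) (Suc k)" if k: "k < b ^ m" for m k
  proof -
    have "expectation (\<lambda>\<omega>. (X m k \<omega>)\<^sup>2) = expectation (\<lambda>\<omega>. (indicator (E m k) \<omega> - prob (E m k))\<^sup>2)"
      by (rule Bochner_Integration.integral_cong) (simp_all add: XE)
    also have "\<dots> = prob (E m k) * (1 - prob (E m k))" by (rule variance_indicator[OF E])
    also have "\<dots> = cell_var H \<Omega> (b ^ m) (Suc k)"
      using cell_var_eq[of "Suc k" "b ^ m"] pB[OF k] k by (simp add: E_def cell_prob_def Suc_le_eq)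
    finally show ?thesis .
  qed
  have sqint: "integrable scr_prob (\<lambda>\<omega>. (X m k \<omega>)\<^sup>2)" for m k
    by (rule integrable_const_bound[of _ 1]) (use bd in \<open>auto simp: abs_square_le_1\<close>)
  have intX: "integrable scr_prob (X m k)" for m k
    by (rule integrable_const_bound[of _ 1]) (use bd in auto)
  define v where "v m = (\<Sum>k<b ^ m. expectation (\<lambda>\<omega>. (X m k \<omega>)\<^sup>2))" for m
  have main: "distr (scr_space b) borel (\<lambda>\<omega>. (mu_hat b H \<Omega> (b ^ m) \<omega> - measure lebesgue \<Omega>) / sqrt (est_var b H \<Omega> (b ^ m)))
      = distr scr_prob borel (\<lambda>\<omega>. (\<Sum>k<b ^ m. X m k \<omega>) / sqrt (v m))" for m
  proof -
    have bm: "real (b ^ m) > 0" using b by simp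
    \<comment> \<open>A version of the estimate that is measurable already for the uncompleted
      product; all integrals and laws are moved to it.\<close>
    let ?G = "\<lambda>\<omega>. measure lebesgue \<Omega> + (\<Sum>k<b ^ m. X m k \<omega>) / real (b ^ m)"
    let ?f = "mu_hat b H \<Omega> (b ^ m)"
    have "(\<Sum>k<b ^ m. prob (E m k)) = real (b ^ m) * measure lebesgue \<Omega>"
      unfolding sum_p[symmetric] E_def by (intro sum.cong) (simp_all add: pB)
    hence G: "?G \<omega> = (\<Sum>k<b ^ m. indicator B (point m k \<omega>)) / real (b ^ m)" for \<omega>
      using bm unfolding X_def sum_subtractf by (simp add: diff_divide_distrib)
    have ae': "AE \<omega> in scr_prob. ?f \<omega> = ?G \<omega>" unfolding G by (rule ae)
    have G_meas: "?G \<in> borel_measurable scr_prob" by measurable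
    have f_meas: "?f \<in> borel_measurable (completion scr_prob)"
      by (rule measurable_completion_AE_eq[OF G_meas ae'])
    note f_meas [measurable] and measurable_completion[OF X, measurable]
    have ae_c: "AE \<omega> in completion scr_prob. ?f \<omega> = ?G \<omega>" by (rule AE_completion[OF ae'])
    have "integral\<^sup>L (completion scr_prob) ?f = integral\<^sup>L (completion scr_prob) ?G"
      by (rule integral_cong_AE[OF f_meas measurable_completion[OF G_meas] ae_c])
    also have "\<dots> = expectation ?G" by (rule integral_completion[OF G_meas])
    also have "\<dots> = measure lebesgue \<Omega>" using intX mean by (simp add: prob_space)
    finally have Ef: "integral\<^sup>L (completion scr_prob) ?f = measure lebesgue \<Omega>" .
    have "est_var b H \<Omega> (b ^ m) = integral\<^sup>L (completion scr_prob) (\<lambda>\<omega>. (?f \<omega> - measure lebesgue \<Omega>)\<^sup>2)"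
      unfolding est_var_def Let_def scr_space_eq Ef ..
    also have "\<dots> = integral\<^sup>L (completion scr_prob) (\<lambda>\<omega>. (?G \<omega> - measure lebesgue \<Omega>)\<^sup>2)"
    proof (rule integral_cong_AE)
      show "AE \<omega> in completion scr_prob. (?f \<omega> - measure lebesgue \<Omega>)\<^sup>2 = (?G \<omega> - measure lebesgue \<Omega>)\<^sup>2"
        using ae_c by eventually_elim simp
    qed measurable
    also have "\<dots> = expectation (\<lambda>\<omega>. (?G \<omega> - measure lebesgue \<Omega>)\<^sup>2)"
      by (rule integral_completion) measurable
    also have "\<dots> = expectation (\<lambda>\<omega>. (\<Sum>k<b ^ m. X m k \<omega>)\<^sup>2) / (real (b ^ m))\<^sup>2"
      by (simp add: power_divide)
    also have "expectation (\<lambda>\<omega>. (\<Sum>k<b ^ m. X m k \<omega>)\<^sup>2) = v m"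
      using variance_indep_sum[OF _ ind sqint mean] by (simp add: v_def)
    finally have "sqrt (est_var b H \<Omega> (b ^ m)) = sqrt (v m) / real (b ^ m)"
      by (simp add: real_sqrt_divide)
    hence "distr (scr_space b) borel (\<lambda>\<omega>. (?f \<omega> - measure lebesgue \<Omega>) / sqrt (est_var b H \<Omega> (b ^ m)))
      = distr (completion scr_prob) borel (\<lambda>\<omega>. (?f \<omega> - measure lebesgue \<Omega>) / (sqrt (v m) / real (b ^ m)))"
      by (simp only: scr_space_eq)
    also have "\<dots> = distr (completion scr_prob) borel (\<lambda>\<omega>. (?G \<omega> - measure lebesgue \<Omega>) / (sqrt (v m) / real (b ^ m)))"
    proof (rule distr_cong_AE[OF refl refl])
      show "AE \<omega> in completion scr_prob. (?f \<omega> - measure lebesgue \<Omega>) / (sqrt (v m) / real (b ^ m))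
        = (?G \<omega> - measure lebesgue \<Omega>) / (sqrt (v m) / real (b ^ m))"
        using ae_c by eventually_elim simp
    qed measurable
    also have "\<dots> = distr scr_prob borel (\<lambda>\<omega>. (?G \<omega> - measure lebesgue \<Omega>) / (sqrt (v m) / real (b ^ m)))"
      by (rule distr_completion) measurable
    also have "(\<lambda>\<omega>. (?G \<omega> - measure lebesgue \<Omega>) / (sqrt (v m) / real (b ^ m))) = (\<lambda>\<omega>. (\<Sum>k<b ^ m. X m k \<omega>) / sqrt (v m))"
      using bm by simp
    finally show ?thesis .
  qed
  show ?thesis
    by (rule that[of X]) (use ind bd mean var main in \<open>auto simp: v_def\<close>)
qed

end

theorem theorem4:
  fixes H :: "real \<Rightarrow> real ^ 'd" and \<Omega> :: "(real ^ 'd) set" and b :: nat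
  assumes b: "b \<ge> 2"
    and H_cont: "continuous_on {0..1} H"
    and H_meas: "H \<in> borel_measurable borel"
    and H_onto: "H ` {0..1} = cbox 0 One"
    and H_vol: "\<And>p q. 0 \<le> p \<Longrightarrow> p \<le> q \<Longrightarrow> q \<le> 1 \<Longrightarrow> measure lebesgue (H ` {p..q}) = q - p"
    and H_unif: "\<And>p q. 0 \<le> p \<Longrightarrow> p < q \<Longrightarrow> q \<le> 1 \<Longrightarrow>
                   distr (uniform_measure lborel {p..q}) borel H = uniform_measure lborel (H ` {p..q})"
    and \<Omega>_meas: "\<Omega> \<in> sets lebesgue"
    and \<Omega>_sub: "\<Omega> \<subseteq> cbox 0 One"
    and var_bound: "\<exists>c>0. \<exists>N0\<ge>1. \<forall>m. b ^ m \<ge> N0 \<longrightarrow>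
                      (\<forall>i \<in> T_bdy H \<Omega> (b ^ m). cell_var H \<Omega> (b ^ m) i \<ge> c)"
    and T_grow: "filterlim (\<lambda>m. card (T_bdy H \<Omega> (b ^ m))) at_top sequentially"
  shows "weak_conv_m
           (\<lambda>m. distr (scr_space b) borel
              (\<lambda>\<omega>. (mu_hat b H \<Omega> (b ^ m) \<omega> - measure lebesgue \<Omega>) / sqrt (est_var b H \<Omega> (b ^ m))))
           std_normal_distribution"
proof -
  interpret scrambled_hilbert H \<Omega> b
    by unfold_locales (fact assms)+
  obtain X where X: "\<And>m. prob_space.indep_vars scr_prob (\<lambda>_. borel) (X m) {..<b ^ m}"
    "\<And>m k \<omega>. \<bar>X m k \<omega>\<bar> \<le> 1"
    "\<And>m k. k < b ^ m \<Longrightarrow> integral\<^sup>L scr_prob (X m k) = 0"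
    and var: "\<And>m k. k < b ^ m \<Longrightarrow> integral\<^sup>L scr_prob (\<lambda>\<omega>. (X m k \<omega>)\<^sup>2) = cell_var H \<Omega> (b ^ m) (Suc k)"
    and distr: "\<And>m. distr (scr_space b) borel (\<lambda>\<omega>. (mu_hat b H \<Omega> (b ^ m) \<omega> - measure lebesgue \<Omega>) / sqrt (est_var b H \<Omega> (b ^ m)))
      = distr scr_prob borel (\<lambda>\<omega>. (\<Sum>k<b ^ m. X m k \<omega>) / sqrt (\<Sum>k<b ^ m. integral\<^sup>L scr_prob (\<lambda>\<omega>. (X m k \<omega>)\<^sup>2)))"
    by (rule estimator_standardized) blast
  let ?v = "\<lambda>m. \<Sum>k<b ^ m. integral\<^sup>L scr_prob (\<lambda>\<omega>. (X m k \<omega>)\<^sup>2)"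
  obtain c N0 where c: "c > 0" and cv: "\<And>m i. b ^ m \<ge> N0 \<Longrightarrow> i \<in> T_bdy H \<Omega> (b ^ m) \<Longrightarrow> cell_var H \<Omega> (b ^ m) i \<ge> c"
    using var_bound by blast
  have v_ge: "c * real (card (T_bdy H \<Omega> (b ^ m))) \<le> ?v m" if "b ^ m \<ge> N0" for m
  proof -
    have sub: "T_bdy H \<Omega> (b ^ m) \<subseteq> {1..b ^ m}" by (auto simp: T_bdy_def)
    have "c * real (card (T_bdy H \<Omega> (b ^ m))) \<le> (\<Sum>i\<in>T_bdy H \<Omega> (b ^ m). cell_var H \<Omega> (b ^ m) i)"
      using sum_bounded_below[of "T_bdy H \<Omega> (b ^ m)" c "cell_var H \<Omega> (b ^ m)"] cv[OF that] by (simp add: mult.commute)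
    \<comment> \<open>Cells off the boundary contribute nonnegative variances, so adding them
      preserves the bound.\<close>
    also have "\<dots> \<le> (\<Sum>i = 1..b ^ m. cell_var H \<Omega> (b ^ m) i)"
      by (rule sum_mono2[OF _ sub]) (simp_all add: cell_var_def Let_def)
    also have "\<dots> = (\<Sum>k<b ^ m. cell_var H \<Omega> (b ^ m) (Suc k))"
      by (rule sum.reindex_bij_witness[of _ Suc "\<lambda>i. i - 1"]) auto
    also have "\<dots> = ?v m" by (intro sum.cong) (simp_all add: var)
    finally show ?thesis .
  qed
  have "filterlim (\<lambda>m. c * real (card (T_bdy H \<Omega> (b ^ m)))) at_top sequentially"
    by (intro filterlim_tendsto_pos_mult_at_top[OF tendsto_const c]
        filterlim_compose[OF filterlim_real_sequentially T_grow])
  moreover have "\<forall>\<^sub>F m in sequentially. c * real (card (T_bdy H \<Omega> (b ^ m))) \<le> ?v m"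
    using eventually_ge_at_top[of N0]
  proof eventually_elim
    case (elim m)
    \<comment> \<open>The threshold \<open>N0\<close> bounds \<open>b ^ m\<close>, not
      \<open>m\<close>; since \<open>m \<le> b ^ m\<close>, it is passed as soon as
      \<open>m \<ge> N0\<close>.\<close>
    have "m \<le> 2 ^ m" by (rule less_imp_le[OF less_exp])
    also have "\<dots> \<le> b ^ m" using b by (rule power_mono) simp
    finally show ?case using elim by (intro v_ge) simp
  qed
  ultimately have v: "filterlim ?v at_top sequentially" by (rule filterlim_at_top_mono)
  show ?thesis unfolding distr
    by (rule clt_triangular_bounded[OF prob_space_scr_prob _ X(1) X(2) X(3) v]) auto
qed

end
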